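(* Let $m\ge 2$ and let $\theta\in\mathbb{R}$ be the true ability parameter in a standard computerized adaptive test (without revision) based on the nominal response model. Suppose that the information-maximizing item selection strategy is used, i.e. for every $i\geq 1$ the $\mathcal{F}_i$-measurable random vector $\mathbf{b}_{i+1}$ satisfies $$\mathbf{b}_{i+1}\in\operatorname*{argmax}_{\mathbf{b}\in\mathbb{B}}J(\hat\theta_i;\mathbf{b}).$$ Then, as $n\to\infty$, $\hat\theta_n$ is asymptotically normal, since $$\sqrt{I_n(\hat\theta_n)}\,(\hat\theta_n-\theta)\to\mathcal{N}(0,1),$$ and asymptotically efficient, in the sense that $$\sqrt n\,(\hat\theta_n-\theta)\to\mathcal{N}\bigl(0,[J^*(\theta)]^{-1}\bigr),$$ where $J^*(\theta)=\sup_{\mathbf{b}\in\mathbb{B}}J(\theta;\mathbf{b})$ and both convergences are in distribution under $\mathsf{P}_\theta$.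
   Context: Nominal response model. Fix an integer $m\ge 2$ (number of categories). An item is characterized by real numbers $a_1,\dots,a_m,c_1,\dots,c_m$ with $\sum_{k=1}^m a_k=\sum_{k=1}^m c_k=0$, $\sum_{k=1}^m|a_k|\ne 0$ and $\sum_{k=1}^m|c_k|\neq 0$; it is identified with the vector $\mathbf{b}=(a_2,\dots,a_m,c_2,\dots,c_m)\in\mathbb{R}^{2m-2}$ (so $a_1=-\sum_{k\ge2}a_k$, $c_1=-\sum_{k\ge 2}c_k$). For $\theta\in\mathbb{R}$ and $1\le k\le m$ set $$p_k(\theta;\mathbf{b})=\frac{\exp(a_k\theta+c_k)}{\sum_{h=1}^m\exp(a_h\theta+c_h)},\qquad \bar a(\theta;\mathbf{b})=\sum_{h=1}^m a_h\,p_h(\theta;\mathbf{b}),$$ $$s(\theta;\mathbf{b},k)=a_k-\bar a(\theta;\mathbf{b}),\qquad J(\theta;\mathbf{b})=\sum_{k=1}^m\bigl(a_k-\bar a(\theta;\mathbf{b})\bigr)^2p_k(\theta;\mathbf{b}).$$ All item vectors take values in a fixed nonempty compact set $\mathbb{B}\subset\mathbb{R}^{2m-2}$, each element $(a_2,\dots,a_m,c_2,\dots,c_m)$ of which, with $a_1=-\sum_{k\ge2}a_k$ and $c_1=-\sum_{k\ge2}c_k$, satisfies $\sum_{k=1}^m|a_k|\ne0$ and $\sum_{k=1}^m|c_k|\ne0$. Standard CAT. $X_i\in\{1,\dots,m\}$ is the response to item $i$, $i\in\mathbb{N}$; $\mathcal{F}_i=\sigma(X_1,\dots,X_i)$, with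 $\mathcal{F}_0$ trivial. An item selection strategy is a sequence $(\mathbf{b}_i)_{i\in\mathbb{N}}$ of $\mathbb{B}$-valued random vectors with $\mathbf{b}_{i+1}$ being $\mathcal{F}_i$-measurable for every $i\ge 0$. Under $\mathsf{P}_\theta$ the responses follow the nominal response model and are conditionally independent given the selected items, i.e. $\mathsf{P}_\theta(X_i=k\mid\mathcal{F}_{i-1})=p_k(\theta;\mathbf{b}_i)$ for all $i\ge1$, $1\le k\le m$. Score and information: for every $\vartheta\in\mathbb{R}$, $S_n(\vartheta)=\sum_{i=1}^n s(\vartheta;\mathbf{b}_i,X_i)$ and $I_n(\vartheta)=\sum_{i=1}^nJ(\vartheta;\mathbf{b}_i)$. Estimator: $\hat\theta_n$ is $\mathcal{F}_n$-measurable and is the (unique) root of $S_n(\cdot)$ whenever a root exists; when no root exists (which can only occur in an initial phase of the test) it is given by some arbitrary $\mathcal{F}_n$-measurable initialization rule. *)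

theory Defs
  imports "HOL-Probability.Probability"
begin

text \<open>
  The categories \<open>2, \<dots>, m\<close> are the elements of a finite type \<open>'k\<close>, and the \<open>m\<close> categories
  are the elements of \<open>'k option\<close>, with \<open>None\<close> as category \<open>1\<close>.  Thus \<open>m = CARD('k) + 1\<close>, and
  \<open>m\<close> ranges over all integers \<open>\<ge> 2\<close> as \<open>'k\<close> ranges over all finite types.
  An item is the pair of vectors \<open>((a\<^sub>2, \<dots>, a\<^sub>m), (c\<^sub>2, \<dots>, c\<^sub>m))\<close>, an element of
  \<open>\<real>\<close> to the power \<open>2m - 2\<close>; the entries \<open>a\<^sub>1\<close> and \<open>c\<^sub>1\<close> are determined by the zero-sum
  constraints.
\<close>

type_synonym 'k item = "(real, 'k) vec \<times> (real, 'k) vec"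

definition slope :: "'k::finite item \<Rightarrow> 'k option \<Rightarrow> real" where
  "slope b k = (case k of None \<Rightarrow> - (\<Sum>j\<in>UNIV. fst b $ j) | Some j \<Rightarrow> fst b $ j)"

definition intercept :: "'k::finite item \<Rightarrow> 'k option \<Rightarrow> real" where
  "intercept b k = (case k of None \<Rightarrow> - (\<Sum>j\<in>UNIV. snd b $ j) | Some j \<Rightarrow> snd b $ j)"

definition admissible_item :: "'k::finite item \<Rightarrow> bool" where
  "admissible_item b \<longleftrightarrow>
     (\<Sum>k\<in>UNIV. \<bar>slope b k\<bar>) \<noteq> 0 \<and> (\<Sum>k\<in>UNIV. \<bar>intercept b k\<bar>) \<noteq> 0"

definition nrm_prob :: "real \<Rightarrow> 'k::finite item \<Rightarrow> 'k option \<Rightarrow> real" where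
  "nrm_prob \<theta> b k =
     exp (slope b k * \<theta> + intercept b k) / (\<Sum>h\<in>UNIV. exp (slope b h * \<theta> + intercept b h))"

definition mean_slope :: "real \<Rightarrow> 'k::finite item \<Rightarrow> real" where
  "mean_slope \<theta> b = (\<Sum>h\<in>UNIV. slope b h * nrm_prob \<theta> b h)"

definition item_score :: "real \<Rightarrow> 'k::finite item \<Rightarrow> 'k option \<Rightarrow> real" where
  "item_score \<theta> b k = slope b k - mean_slope \<theta> b"

definition item_info :: "real \<Rightarrow> 'k::finite item \<Rightarrow> real" where
  "item_info \<theta> b = (\<Sum>k\<in>UNIV. (slope b k - mean_slope \<theta> b)\<^sup>2 * nrm_prob \<theta> b k)"

definition max_info :: "'k::finite item set \<Rightarrow> real \<Rightarrow> real" where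
  "max_info B \<theta> = (SUP b\<in>B. item_info \<theta> b)"

text \<open>
  In the following, items and responses are numbered from \<open>1\<close>; the values of \<open>b\<close> and \<open>X\<close> at
  index \<open>0\<close> are never used.
\<close>

definition response_filtration ::
    "'w measure \<Rightarrow> (nat \<Rightarrow> 'w \<Rightarrow> 'k option) \<Rightarrow> nat \<Rightarrow> 'w measure" where
  "response_filtration M X n =
     sigma (space M) {{\<omega> \<in> space M. X i \<omega> = k} | i k. i \<in> {1..n}}"

definition score ::
    "(nat \<Rightarrow> 'w \<Rightarrow> 'k::finite item) \<Rightarrow> (nat \<Rightarrow> 'w \<Rightarrow> 'k option) \<Rightarrow> nat \<Rightarrow> real \<Rightarrow> 'w \<Rightarrow> real" where
  "score b X n t \<omega> = (\<Sum>i=1..n. item_score t (b i \<omega>) (X i \<omega>))"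

definition info :: "(nat \<Rightarrow> 'w \<Rightarrow> 'k::finite item) \<Rightarrow> nat \<Rightarrow> real \<Rightarrow> 'w \<Rightarrow> real" where
  "info b n t \<omega> = (\<Sum>i=1..n. item_info t (b i \<omega>))"

definition item_selection_strategy ::
    "'w measure \<Rightarrow> 'k::finite item set \<Rightarrow> (nat \<Rightarrow> 'w \<Rightarrow> 'k option) \<Rightarrow> (nat \<Rightarrow> 'w \<Rightarrow> 'k item) \<Rightarrow> bool"
where
  "item_selection_strategy M B X b \<longleftrightarrow>
     (\<forall>i. b (Suc i) \<in> response_filtration M X i \<rightarrow>\<^sub>M borel) \<and>
     (\<forall>i\<ge>1. \<forall>\<omega>\<in>space M. b i \<omega> \<in> B)"

definition nrm_responses ::
    "'w measure \<Rightarrow> real \<Rightarrow> (nat \<Rightarrow> 'w \<Rightarrow> 'k::finite option) \<Rightarrow> (nat \<Rightarrow> 'w \<Rightarrow> 'k item) \<Rightarrow> bool"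
where
  "nrm_responses M \<theta> X b \<longleftrightarrow>
     (\<forall>i\<ge>1. X i \<in> M \<rightarrow>\<^sub>M count_space UNIV) \<and>
     (\<forall>i\<ge>1. \<forall>k. AE \<omega> in M.
        real_cond_exp M (response_filtration M X (i - 1)) (indicator {\<omega> \<in> space M. X i \<omega> = k}) \<omega>
          = nrm_prob \<theta> (b i \<omega>) k)"

text \<open>
  For \<open>n \<ge> 1\<close> and admissible items the score is strictly decreasing in the ability, so a root is
  unique.  Where there is no root, the estimator is only required to be measurable, which is the
  arbitrary initialization rule.
\<close>

definition ability_estimator ::
    "'w measure \<Rightarrow> (nat \<Rightarrow> 'w \<Rightarrow> 'k::finite option) \<Rightarrow> (nat \<Rightarrow> 'w \<Rightarrow> 'k item)
      \<Rightarrow> (nat \<Rightarrow> 'w \<Rightarrow> real) \<Rightarrow> bool"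
where
  "ability_estimator M X b \<theta>hat \<longleftrightarrow>
     (\<forall>n\<ge>1. \<theta>hat n \<in> borel_measurable (response_filtration M X n)) \<and>
     (\<forall>n\<ge>1. \<forall>\<omega>\<in>space M. (\<exists>t. score b X n t \<omega> = 0) \<longrightarrow> score b X n (\<theta>hat n \<omega>) \<omega> = 0)"

end

theory Submission
  imports Defs
begin

text \<open>
  At the true ability the score \<open>S\<^sub>n\<close> is a martingale with bounded increments and conditional
  variances \<open>J(\<theta>; b\<^sub>i)\<close>, so \<open>S\<^sub>n / n\<close> tends to \<open>0\<close> in \<open>L\<^sup>2\<close>.  The score decreases in the ability
  at a rate bounded below on \<open>B\<close>, hence by Chebyshev's inequality the root exists and is close to
  \<open>\<theta>\<close> with probability tending to \<open>1\<close>.  Consistency in probability suffices: since the items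
  maximize the information at the estimate and \<open>item_info\<close> is bounded and uniformly continuous,
  \<open>J(\<theta>; b\<^sub>i)\<close> tends to \<open>J = max_info B \<theta>\<close> in \<open>L\<^sup>1\<close>, and so do the averages.  With this the
  characteristic function of \<open>S\<^sub>n / \<surd>n\<close> is compared with that of the normal distribution of variance
  \<open>J\<close> by replacing one increment at a time.  Finally, the mean value theorem gives
  \<open>S\<^sub>n = (\<theta>hat\<^sub>n - \<theta>) \<sqdot> n R\<^sub>n\<close> with \<open>R\<^sub>n\<close> tending to \<open>J\<close> in probability.
\<close>

section \<open>Items of the nominal response model\<close>

lemma sum_option_UNIV:
  fixes f :: "'k::finite option \<Rightarrow> 'a::comm_monoid_add"
  shows "(\<Sum>k\<in>UNIV. f k) = f None + (\<Sum>j\<in>UNIV. f (Some j))"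
  by (simp add: UNIV_option_conv sum.reindex)

lemma sum_slope: "(\<Sum>k\<in>UNIV. slope v k) = 0"
  by (simp add: sum_option_UNIV slope_def)

lemma continuous_on_slope [continuous_intros]:
  "continuous_on S f \<Longrightarrow> continuous_on S (\<lambda>x. slope (f x) k)"
  unfolding slope_def by (cases k) (auto intro!: continuous_intros)

lemma continuous_on_intercept [continuous_intros]:
  "continuous_on S f \<Longrightarrow> continuous_on S (\<lambda>x. intercept (f x) k)"
  unfolding intercept_def by (cases k) (auto intro!: continuous_intros)

lemma sum_exp_pos: "0 < (\<Sum>h\<in>UNIV. exp (slope v h * t + intercept v h))"
  by (rule sum_pos) auto

lemma continuous_on_nrm_prob [continuous_intros]:
  "continuous_on S f \<Longrightarrow> continuous_on S g \<Longrightarrow> continuous_on S (\<lambda>x. nrm_prob (f x) (g x) k)"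
  unfolding nrm_prob_def
  by (intro continuous_intros ballI) (auto simp: less_imp_neq[OF sum_exp_pos, symmetric])

lemma continuous_on_mean_slope [continuous_intros]:
  "continuous_on S f \<Longrightarrow> continuous_on S g \<Longrightarrow> continuous_on S (\<lambda>x. mean_slope (f x) (g x))"
  unfolding mean_slope_def by (intro continuous_intros)

lemma continuous_on_item_score [continuous_intros]:
  "continuous_on S f \<Longrightarrow> continuous_on S g \<Longrightarrow> continuous_on S (\<lambda>x. item_score (f x) (g x) k)"
  unfolding item_score_def by (intro continuous_intros)

lemma continuous_on_item_info [continuous_intros]:
  "continuous_on S f \<Longrightarrow> continuous_on S g \<Longrightarrow> continuous_on S (\<lambda>x. item_info (f x) (g x))"
  unfolding item_info_def by (intro continuous_intros)

lemma nrm_prob_pos: "0 < nrm_prob t v k"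
  unfolding nrm_prob_def by (simp add: sum_exp_pos)

lemma nrm_prob_nonneg [simp]: "0 \<le> nrm_prob t v k"
  using nrm_prob_pos by (rule less_imp_le)

lemma sum_nrm_prob: "(\<Sum>k\<in>UNIV. nrm_prob t v k) = 1"
  using sum_exp_pos[of v t] by (simp add: nrm_prob_def flip: sum_divide_distrib)

text \<open>Subtracting \<open>mean_slope\<close> centres the slopes under the category
  probabilities at the same ability. At \<open>\<theta>\<close> this makes the increments of the
  score martingale differences.\<close>

lemma sum_nrm_prob_score: "(\<Sum>k\<in>UNIV. nrm_prob t v k * item_score t v k) = 0"
proof -
  have "(\<Sum>k\<in>UNIV. nrm_prob t v k * item_score t v k)
      = mean_slope t v - mean_slope t v * (\<Sum>k\<in>UNIV. nrm_prob t v k)"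
    by (simp add: item_score_def right_diff_distrib sum_subtractf sum_distrib_left
        mean_slope_def[of t v, symmetric] mult.commute)
  then show ?thesis by (simp add: sum_nrm_prob)
qed

lemma item_info_eq: "item_info t v = (\<Sum>k\<in>UNIV. nrm_prob t v k * (item_score t v k)\<^sup>2)"
  by (simp add: item_info_def item_score_def mult.commute)

lemma item_info_nonneg: "0 \<le> item_info t v"
  unfolding item_info_eq by (simp add: sum_nonneg)

text \<open>The information is the variance of the slope under strictly positive probabilities. If
  it vanished, all slopes would be equal, hence zero by the zero-sum constraint, which admissibility
  excludes.\<close>

lemma item_info_pos:
  assumes "admissible_item v"
  shows "0 < item_info t v"
proof -
  have "item_info t v \<noteq> 0"
  proof
    assume "item_info t v = 0"
    then have zero: "nrm_prob t v k * (item_score t v k)\<^sup>2 = 0" for k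
      unfolding item_info_eq
      by (subst (asm) sum_nonneg_eq_0_iff) auto
    then have eq: "slope v k = mean_slope t v" for k
      using zero[of k] nrm_prob_pos[of t v k] by (auto simp: item_score_def)
    then have "real (card (UNIV :: 'a option set)) * mean_slope t v = 0"
      using sum_slope[of v] by simp
    then have "slope v k = 0" for k
      using eq by simp
    then show False
      using assms by (simp add: admissible_item_def)
  qed
  then show ?thesis
    using item_info_nonneg[of t v] by simp
qed

section \<open>Derivatives in the ability\<close>

lemma has_real_derivative_nrm_prob:
  "((\<lambda>t. nrm_prob t v k) has_real_derivative nrm_prob t v k * item_score t v k) (at t)"
proof -
  let ?w = "\<lambda>t h. exp (slope v h * t + intercept v h)"
  let ?Z = "\<lambda>t. \<Sum>h\<in>UNIV. ?w t h"
  have nz: "?Z t \<noteq> 0" using sum_exp_pos[of v t] by simp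
  have ms: "mean_slope t v = (\<Sum>h\<in>UNIV. slope v h * ?w t h) / ?Z t"
    by (simp add: mean_slope_def nrm_prob_def sum_divide_distrib)
  have "((\<lambda>t. ?w t k / ?Z t) has_real_derivative
      (slope v k * ?w t k * ?Z t - ?w t k * (\<Sum>h\<in>UNIV. slope v h * ?w t h)) / (?Z t * ?Z t)) (at t)"
    by (rule derivative_eq_intros refl nz | simp add: mult.commute)+
  also have "(slope v k * ?w t k * ?Z t - ?w t k * (\<Sum>h\<in>UNIV. slope v h * ?w t h)) / (?Z t * ?Z t)
      = nrm_prob t v k * item_score t v k"
    unfolding item_score_def ms nrm_prob_def using nz by (simp add: field_simps)
  finally show ?thesis by (simp add: nrm_prob_def)
qed

text \<open>The derivative of the mean is the sum of slope times probability times score. Writing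
  the slope as score plus mean leaves the variance, since the score is centred. So the information
  is minus the derivative of the item score.\<close>

lemma has_real_derivative_mean_slope:
  "((\<lambda>t. mean_slope t v) has_real_derivative item_info t v) (at t)"
proof -
  have "((\<lambda>t. mean_slope t v) has_real_derivative
      (\<Sum>h\<in>UNIV. slope v h * (nrm_prob t v h * item_score t v h))) (at t)"
    unfolding mean_slope_def
    by (intro DERIV_sum DERIV_cmult has_real_derivative_nrm_prob)
  also have "(\<Sum>h\<in>UNIV. slope v h * (nrm_prob t v h * item_score t v h))
      = item_info t v + mean_slope t v * (\<Sum>h\<in>UNIV. nrm_prob t v h * item_score t v h)"
    by (simp add: item_info_eq sum_distrib_left power2_eq_square flip: sum.distrib)
       (simp add: item_score_def algebra_simps)
  finally show ?thesis by (simp add: sum_nrm_prob_score)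
qed

lemma mean_slope_strict_mono:
  assumes "admissible_item v" "s < t"
  shows "mean_slope s v < mean_slope t v"
  using assms(2)
  by (rule DERIV_pos_imp_increasing) (use has_real_derivative_mean_slope item_info_pos[OF assms(1)] in blast)

text \<open>The intermediate point of the mean value theorem lies between \<open>t\<close> and
  \<open>\<theta>\<close>, so its information is within \<open>\<eta>\<close> of that at
  \<open>\<theta>\<close>. The product form with a factor \<open>r\<close> includes the case
  \<open>t = \<theta>\<close>.\<close>

lemma mean_slope_mvt:
  assumes close: "\<And>s. \<bar>s - \<theta>\<bar> < \<delta> \<Longrightarrow> \<bar>item_info s v - item_info \<theta> v\<bar> \<le> \<eta>"
    and t: "\<bar>t - \<theta>\<bar> < \<delta>"
  shows "\<exists>r. mean_slope t v - mean_slope \<theta> v = (t - \<theta>) * r \<and> \<bar>r - item_info \<theta> v\<bar> \<le> \<eta>"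
proof (cases t \<theta> rule: linorder_cases)
  case less
  then obtain s where "t < s" "s < \<theta>" "mean_slope \<theta> v - mean_slope t v = (\<theta> - t) * item_info s v"
    using MVT2[of t \<theta> "\<lambda>t. mean_slope t v" "\<lambda>t. item_info t v"] has_real_derivative_mean_slope by blast
  with close[of s] t show ?thesis
    by (intro exI[of _ "item_info s v"]) (auto simp: algebra_simps)
next
  case equal
  then show ?thesis using close[of \<theta>] t by (intro exI[of _ "item_info \<theta> v"]) auto
next
  case greater
  then obtain s where "\<theta> < s" "s < t" "mean_slope t v - mean_slope \<theta> v = (t - \<theta>) * item_info s v"
    using MVT2[of \<theta> t "\<lambda>t. mean_slope t v" "\<lambda>t. item_info t v"] has_real_derivative_mean_slope by blast
  with close[of s] t show ?thesis
    by (intro exI[of _ "item_info s v"]) (auto simp: algebra_simps)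
qed

text \<open>Second-order Taylor expansion of the characteristic function of a single score: the
  linear term vanishes by centring, the quadratic term gives the information, and the remainder is
  cubic.\<close>

lemma item_score_char_approx:
  assumes le: "\<And>k. \<bar>item_score t v k\<bar> \<le> K"
  shows "cmod ((\<Sum>k\<in>UNIV. complex_of_real (nrm_prob t v k) * iexp (h * item_score t v k))
      - complex_of_real (1 - h\<^sup>2 * item_info t v / 2)) \<le> \<bar>h\<bar> ^ 3 * K ^ 3"
proof -
  let ?q = "\<lambda>x. \<Sum>j\<le>2. (\<i> * complex_of_real x) ^ j / fact j"
  have q: "?q x = 1 + \<i> * x - complex_of_real (x\<^sup>2 / 2)" for x
    by (simp add: numeral_2_eq_2 power2_eq_square fact_numeral) (simp add: complex_eq_iff)
  have "(\<Sum>k\<in>UNIV. complex_of_real (nrm_prob t v k) * ?q (h * item_score t v k))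
      = complex_of_real (\<Sum>k\<in>UNIV. nrm_prob t v k)
        + \<i> * h * complex_of_real (\<Sum>k\<in>UNIV. nrm_prob t v k * item_score t v k)
        - complex_of_real (h\<^sup>2 / 2 * (\<Sum>k\<in>UNIV. nrm_prob t v k * (item_score t v k)\<^sup>2))"
    unfolding q
    by (simp add: ring_distribs sum.distrib sum_subtractf sum_distrib_left power_mult_distrib mult_ac)
  also have "\<dots> = complex_of_real (1 - h\<^sup>2 * item_info t v / 2)"
    by (simp add: sum_nrm_prob sum_nrm_prob_score item_info_eq)
  finally have "(\<Sum>k\<in>UNIV. complex_of_real (nrm_prob t v k) * iexp (h * item_score t v k))
      - complex_of_real (1 - h\<^sup>2 * item_info t v / 2)
    = (\<Sum>k\<in>UNIV. complex_of_real (nrm_prob t v k)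
        * (iexp (h * item_score t v k) - ?q (h * item_score t v k)))"
    by (simp only: right_diff_distrib sum_subtractf)
  also have "cmod \<dots> \<le> (\<Sum>k\<in>UNIV. nrm_prob t v k * (\<bar>h\<bar> ^ 3 * K ^ 3))"
  proof (rule sum_norm_le)
    fix k
    have "cmod (iexp (h * item_score t v k) - ?q (h * item_score t v k))
        \<le> \<bar>h * item_score t v k\<bar> ^ 3 / fact 3"
      using iexp_approx1[of "h * item_score t v k" 2] by (simp add: numeral_3_eq_3 numeral_2_eq_2)
    \<comment> \<open>The factor \<open>1 / fact 3\<close> is given up, since only the order in
      \<open>h\<close> matters.\<close>
    also have "\<dots> \<le> \<bar>h * item_score t v k\<bar> ^ 3 / 1"
      by (intro divide_left_mono) (auto simp: fact_numeral)
    also have "\<dots> \<le> \<bar>h\<bar> ^ 3 * K ^ 3"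
      using le[of k] by (simp add: abs_mult power_mult_distrib mult_left_mono power_mono)
    finally show "cmod (complex_of_real (nrm_prob t v k)
        * (iexp (h * item_score t v k) - ?q (h * item_score t v k))) \<le> nrm_prob t v k * (\<bar>h\<bar> ^ 3 * K ^ 3)"
      by (simp add: norm_mult mult_left_mono)
  qed
  also have "\<dots> = \<bar>h\<bar> ^ 3 * K ^ 3"
    by (simp add: sum_nrm_prob flip: sum_distrib_right)
  finally show ?thesis .
qed

section \<open>Measurability at random abilities and items\<close>

lemma measurable_item_info:
  fixes v :: "_ \<Rightarrow> 'k::finite item"
  assumes "f \<in> borel_measurable N" "v \<in> borel_measurable N"
  shows "(\<lambda>\<omega>. item_info (f \<omega>) (v \<omega>)) \<in> borel_measurable N"
  by (rule borel_measurable_continuous_Pair[where H = "item_info", OF assms]) (intro continuous_intros)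

lemma measurable_nrm_prob:
  fixes v :: "_ \<Rightarrow> 'k::finite item"
  assumes "f \<in> borel_measurable N" "v \<in> borel_measurable N"
  shows "(\<lambda>\<omega>. nrm_prob (f \<omega>) (v \<omega>) k) \<in> borel_measurable N"
  by (rule borel_measurable_continuous_Pair[where H = "\<lambda>t v. nrm_prob t v k", OF assms]) (intro continuous_intros)

lemma measurable_item_score:
  fixes v :: "_ \<Rightarrow> 'k::finite item"
  assumes "f \<in> borel_measurable N" "v \<in> borel_measurable N"
  shows "(\<lambda>\<omega>. item_score (f \<omega>) (v \<omega>) k) \<in> borel_measurable N"
  by (rule borel_measurable_continuous_Pair[where H = "\<lambda>t v. item_score t v k", OF assms]) (intro continuous_intros)

section \<open>Limits and characteristic functions\<close>

text \<open>The difference is nonnegative by convexity, and at most \<open>x\<^sup>2\<close> because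
  \<open>exp (- x) \<le> 1 / (1 + x) \<le> 1 - x + x\<^sup>2\<close>.\<close>

lemma one_minus_exp_neg_bounds:
  fixes x :: real
  assumes "0 \<le> x"
  shows "\<bar>exp (- x) - (1 - x)\<bar> \<le> x\<^sup>2"
proof -
  have 1: "1 - x \<le> exp (- x)" using exp_ge_add_one_self[of "-x"] by simp
  have "exp (- x) * (1 + x) \<le> exp (- x) * exp x"
    by (intro mult_left_mono) (auto simp: exp_ge_add_one_self)
  then have "exp (- x) * (1 + x) \<le> 1" by (simp add: exp_minus)
  then have "exp (-x) \<le> 1 / (1 + x)" using assms by (simp add: field_simps)
  also have "\<dots> \<le> 1 - x + x\<^sup>2"
    using assms by (simp add: divide_simps) (simp add: algebra_simps power2_eq_square)
  finally show ?thesis using 1 by simp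
qed

text \<open>The first \<open>N\<close> terms contribute at most a constant \<open>C\<close>, which
  is below \<open>n * (e / 2)\<close> for large \<open>n\<close>; each later term is below
  \<open>e / 2\<close>.\<close>

lemma tendsto_cesaro_zero:
  fixes a :: "nat \<Rightarrow> real"
  assumes lim: "a \<longlonglongrightarrow> 0"
  shows "(\<lambda>n. (\<Sum>i<n. a i) / n) \<longlonglongrightarrow> 0"
proof (rule LIMSEQ_I)
  fix e :: real assume e: "0 < e"
  obtain N where N: "\<And>n. n \<ge> N \<Longrightarrow> \<bar>a n\<bar> < e / 2"
    using LIMSEQ_D[OF lim, of "e/2"] e by auto
  define C where "C = (\<Sum>i<N. \<bar>a i\<bar>)"
  obtain N' where N': "real N' > 2 * C / e" using reals_Archimedean2 by blast
  show "\<exists>no. \<forall>n\<ge>no. norm ((\<Sum>i<n. a i) / n - 0) < e"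
  proof (intro exI[of _ "max (Suc N) N'"] allI impI)
    fix n assume n: "n \<ge> max (Suc N) N'"
    have "\<bar>\<Sum>i<n. a i\<bar> \<le> (\<Sum>i<n. \<bar>a i\<bar>)" by simp
    also have "\<dots> = C + (\<Sum>i\<in>{N..<n}. \<bar>a i\<bar>)"
      unfolding C_def using n by (subst sum.union_disjoint[symmetric]) (auto intro!: sum.cong)
    also have "(\<Sum>i\<in>{N..<n}. \<bar>a i\<bar>) \<le> (\<Sum>i\<in>{N..<n}. e / 2)"
      by (intro sum_mono) (use N in \<open>auto intro: less_imp_le\<close>)
    also have "\<dots> \<le> n * (e / 2)" using e by (simp add: mult_right_mono)
    also have "C < n * (e / 2)"
    proof -
      have "2 * C / e < n" using N' n by simp
      then show ?thesis using e by (simp add: field_simps)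
    qed
    finally have "\<bar>\<Sum>i<n. a i\<bar> < e * n" by (simp add: mult.commute)
    then show "norm ((\<Sum>i<n. a i) / n - 0) < e" using n by (simp add: divide_less_eq)
  qed
qed

text \<open>
  A form of Slutsky's theorem: \<open>G n\<close> is \<open>W n\<close> times a random factor that tends to \<open>q\<close> in
  probability.
\<close>

context prob_space
begin

lemma weak_conv_m_normal_perturb:
  fixes W G :: "nat \<Rightarrow> 'a \<Rightarrow> real"
  assumes W [measurable]: "\<And>n. W n \<in> borel_measurable M"
    and G [measurable]: "\<And>n. G n \<in> borel_measurable M"
    and W2: "\<And>n. integrable M (\<lambda>\<omega>. (W n \<omega>)\<^sup>2)" "\<And>n. expectation (\<lambda>\<omega>. (W n \<omega>)\<^sup>2) \<le> C"
    and char: "\<And>t. (\<lambda>n. expectation (\<lambda>\<omega>. iexp (t * W n \<omega>))) \<longlonglongrightarrow> exp (- (t\<^sup>2 * \<sigma>\<^sup>2 / 2))"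
    and close: "\<And>\<epsilon>. 0 < \<epsilon> \<Longrightarrow>
      (\<lambda>n. prob {\<omega>\<in>space M. \<not> \<bar>G n \<omega> - q * W n \<omega>\<bar> \<le> \<epsilon> * \<bar>W n \<omega>\<bar>}) \<longlonglongrightarrow> 0"
    and "0 < q" "0 < \<sigma>"
  shows "weak_conv_m (\<lambda>n. distr M borel (G n)) (density lborel (normal_density 0 (q * \<sigma>)))"
proof (rule levy_continuity)
  show "real_distribution (distr M borel (G n))" for n by simp
  \<comment> \<open>The limit law is identified as the image of the standard normal law under
    scaling by \<open>q * \<sigma>\<close>, which gives its characteristic function.\<close>
  interpret N: prob_space std_normal_distribution by (rule prob_space_normal_density) simp
  have "distributed std_normal_distribution lborel (\<lambda>x. x) std_normal_density"
    by (auto simp: distributed_def distr_id2)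
  from N.normal_density_affine[OF this, of "q * \<sigma>" 0] \<open>0 < q\<close> \<open>0 < \<sigma>\<close>
  have "distributed std_normal_distribution lborel (\<lambda>x. q * \<sigma> * x) (normal_density 0 (q * \<sigma>))"
    by simp
  then have eq: "density lborel (normal_density 0 (q * \<sigma>))
      = distr std_normal_distribution borel (\<lambda>x. q * \<sigma> * x)"
    by (auto simp: distributed_def cong: distr_cong)
  show "real_distribution (density lborel (normal_density 0 (q * \<sigma>)))"
    unfolding eq by (simp add: N.real_distribution_distr)
  fix t :: real
  have "char (density lborel (normal_density 0 (q * \<sigma>))) t = char std_normal_distribution (t * q * \<sigma>)"
    unfolding eq char_def by (subst integral_distr) (auto simp: mult_ac)
  also have "\<dots> = exp (- ((t * q)\<^sup>2 * \<sigma>\<^sup>2 / 2))"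
    by (simp add: char_std_normal_distribution power_mult_distrib)
  finally have charN: "char (density lborel (normal_density 0 (q * \<sigma>))) t
      = exp (- ((t * q)\<^sup>2 * \<sigma>\<^sup>2 / 2))" .
  define bad where "bad \<epsilon> n = {\<omega>\<in>space M. \<not> \<bar>G n \<omega> - q * W n \<omega>\<bar> \<le> \<epsilon> * \<bar>W n \<omega>\<bar>}" for \<epsilon> n
  have bad [measurable]: "bad \<epsilon> n \<in> sets M" for \<epsilon> n unfolding bad_def by measurable
  have iG: "integrable M (\<lambda>\<omega>. iexp (t * G n \<omega>))" for n
    by (rule integrable_const_bound[of _ 1]) auto
  have iW: "integrable M (\<lambda>\<omega>. iexp (t * q * W n \<omega>))" for n
    by (rule integrable_const_bound[of _ 1]) auto
  \<comment> \<open>On the bad event the two exponentials differ by at most \<open>2\<close>,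
    elsewhere by at most \<open>\<bar>t\<bar> * \<epsilon> * \<bar>W n \<omega>\<bar>\<close>.
    Replacing \<open>\<bar>W n \<omega>\<bar>\<close> by \<open>1 + (W n \<omega>)\<^sup>2\<close>
    brings in the second moment bound \<open>C\<close>.\<close>
  have bound: "cmod (expectation (\<lambda>\<omega>. iexp (t * G n \<omega>)) - expectation (\<lambda>\<omega>. iexp (t * q * W n \<omega>)))
      \<le> 2 * prob (bad \<epsilon> n) + \<bar>t\<bar> * \<epsilon> * (1 + C)" if "0 < \<epsilon>" for n \<epsilon>
  proof -
    have "cmod (expectation (\<lambda>\<omega>. iexp (t * G n \<omega>)) - expectation (\<lambda>\<omega>. iexp (t * q * W n \<omega>)))
        = cmod (expectation (\<lambda>\<omega>. iexp (t * G n \<omega>) - iexp (t * q * W n \<omega>)))"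
      by (subst Bochner_Integration.integral_diff[OF iG iW]) simp
    also have "\<dots> \<le> expectation (\<lambda>\<omega>. cmod (iexp (t * G n \<omega>) - iexp (t * q * W n \<omega>)))"
      by (rule integral_norm_bound)
    also have "\<dots> \<le> expectation (\<lambda>\<omega>. 2 * indicator (bad \<epsilon> n) \<omega> + \<bar>t\<bar> * \<epsilon> * (1 + (W n \<omega>)\<^sup>2))"
    proof (rule integral_mono)
      fix \<omega> assume \<omega>: "\<omega> \<in> space M"
      show "cmod (iexp (t * G n \<omega>) - iexp (t * q * W n \<omega>))
          \<le> 2 * indicator (bad \<epsilon> n) \<omega> + \<bar>t\<bar> * \<epsilon> * (1 + (W n \<omega>)\<^sup>2)"
      proof (cases "\<omega> \<in> bad \<epsilon> n")
        case True
        have "cmod (iexp (t * G n \<omega>) - iexp (t * q * W n \<omega>)) \<le> 1 + 1"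
          by (rule norm_triangle_le_diff) simp
        then show ?thesis using True that by (simp add: add_increasing2)
      next
        case False
        have "iexp (t * G n \<omega>) - iexp (t * q * W n \<omega>)
            = iexp (t * q * W n \<omega>) * (iexp (t * (G n \<omega> - q * W n \<omega>)) - 1)"
          by (simp add: algebra_simps flip: exp_add)
        then have "cmod (iexp (t * G n \<omega>) - iexp (t * q * W n \<omega>))
            = cmod (iexp (t * (G n \<omega> - q * W n \<omega>)) - 1)"
          by (simp add: norm_mult)
        also have "\<dots> \<le> \<bar>t * (G n \<omega> - q * W n \<omega>)\<bar>"
          using iexp_approx1[of "t * (G n \<omega> - q * W n \<omega>)" 0] by simp
        also have "\<dots> \<le> \<bar>t\<bar> * (\<epsilon> * \<bar>W n \<omega>\<bar>)"
          unfolding abs_mult using False \<omega> by (intro mult_left_mono) (auto simp: bad_def)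
        also have "\<dots> \<le> \<bar>t\<bar> * (\<epsilon> * (1 + (W n \<omega>)\<^sup>2))"
        proof -
          have "2 * \<bar>W n \<omega>\<bar> \<le> 1 + (W n \<omega>)\<^sup>2"
            using zero_le_power2[of "\<bar>W n \<omega>\<bar> - 1"] by (simp add: power2_diff)
          then have "\<bar>W n \<omega>\<bar> \<le> 1 + (W n \<omega>)\<^sup>2" by linarith
          then show ?thesis using that by (intro mult_left_mono) auto
        qed
        finally show ?thesis using False by simp
      qed
    next
      show "integrable M (\<lambda>\<omega>. 2 * indicator (bad \<epsilon> n) \<omega> + \<bar>t\<bar> * \<epsilon> * (1 + (W n \<omega>)\<^sup>2))"
        using W2(1) by (intro Bochner_Integration.integrable_add integrable_mult_right integrable_real_indicator)
            (auto simp: emeasure_eq_measure)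
    qed (use iG iW in auto)
    also have "\<dots> = 2 * prob (bad \<epsilon> n) + \<bar>t\<bar> * \<epsilon> * (1 + expectation (\<lambda>\<omega>. (W n \<omega>)\<^sup>2))"
    proof -
      have "integrable M (\<lambda>\<omega>. 2 * indicator (bad \<epsilon> n) \<omega> :: real)"
        by (intro integrable_mult_right integrable_real_indicator) (auto simp: emeasure_eq_measure)
      moreover have "integrable M (\<lambda>\<omega>. \<bar>t\<bar> * \<epsilon> * (1 + (W n \<omega>)\<^sup>2))"
        using W2(1) by (intro Bochner_Integration.integrable_add integrable_mult_right) auto
      ultimately show ?thesis
        using W2(1)[of n] by (subst Bochner_Integration.integral_add) (auto simp: prob_space)
    qed
    also have "\<dots> \<le> 2 * prob (bad \<epsilon> n) + \<bar>t\<bar> * \<epsilon> * (1 + C)"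
      using that W2(2)[of n] by (intro add_left_mono mult_left_mono) auto
    finally show ?thesis .
  qed
  have C0: "0 \<le> C"
    using W2(2)[of 0] by (rule order_trans[rotated]) simp
  have "(\<lambda>n. expectation (\<lambda>\<omega>. iexp (t * G n \<omega>)) - expectation (\<lambda>\<omega>. iexp (t * q * W n \<omega>))) \<longlonglongrightarrow> 0"
  proof (rule LIMSEQ_I)
    fix e :: real assume e: "0 < e"
    \<comment> \<open>The summand \<open>1\<close> next to \<open>\<bar>t\<bar>\<close> keeps the
      denominator positive at \<open>t = 0\<close>.\<close>
    define \<epsilon> where "\<epsilon> = e / (2 * (\<bar>t\<bar> + 1) * (1 + C))"
    have \<epsilon>: "0 < \<epsilon>" using e C0 by (simp add: \<epsilon>_def)
    have "\<bar>t\<bar> * \<epsilon> * (1 + C) \<le> (\<bar>t\<bar> + 1) * \<epsilon> * (1 + C)"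
      using \<epsilon> C0 by (intro mult_right_mono) auto
    also have "\<dots> = e / 2"
    proof -
      have "(\<bar>t\<bar> + 1) * (1 + C) \<noteq> 0" using C0 by auto
      then show ?thesis by (simp add: \<epsilon>_def field_simps)
    qed
    finally have small: "\<bar>t\<bar> * \<epsilon> * (1 + C) \<le> e / 2" .
    obtain N where N: "\<And>n. n \<ge> N \<Longrightarrow> prob (bad \<epsilon> n) < e / 4"
      using LIMSEQ_D[OF close[OF \<epsilon>], of "e / 4"] e unfolding bad_def by auto
    show "\<exists>N. \<forall>n\<ge>N. norm (expectation (\<lambda>\<omega>. iexp (t * G n \<omega>))
        - expectation (\<lambda>\<omega>. iexp (t * q * W n \<omega>)) - 0) < e"
    proof (intro exI[of _ N] allI impI)
      fix n assume "N \<le> n"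
      from bound[OF \<epsilon>, of n] N[OF this] small
      show "norm (expectation (\<lambda>\<omega>. iexp (t * G n \<omega>)) - expectation (\<lambda>\<omega>. iexp (t * q * W n \<omega>)) - 0) < e"
        by (simp only: diff_zero)
    qed
  qed
  from tendsto_add[OF this char[of "t * q"]]
  have "(\<lambda>n. expectation (\<lambda>\<omega>. iexp (t * G n \<omega>))) \<longlonglongrightarrow> exp (- ((t * q)\<^sup>2 * \<sigma>\<^sup>2 / 2))"
    by simp
  then show "(\<lambda>n. char (distr M borel (G n)) t) \<longlonglongrightarrow> char (density lborel (normal_density 0 (q * \<sigma>))) t"
    unfolding charN by (simp add: char_def integral_distr)
qed

end

section \<open>Score and consistency\<close>

text \<open>The assumptions are those of the theorem, which interprets the locale at the
  end.\<close>

locale info_maximizing_cat = prob_space M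
  for M :: "'w measure"
    and \<theta> :: real
    and B :: "'k::finite item set"
    and X :: "nat \<Rightarrow> 'w \<Rightarrow> 'k option"
    and b :: "nat \<Rightarrow> 'w \<Rightarrow> 'k item"
    and \<theta>hat :: "nat \<Rightarrow> 'w \<Rightarrow> real" +
  assumes compact_B: "compact B"
    and B_nonempty: "B \<noteq> {}"
    and B_admissible: "\<And>v. v \<in> B \<Longrightarrow> admissible_item v"
    and strategy: "item_selection_strategy M B X b"
    and responses: "nrm_responses M \<theta> X b"
    and estimator: "ability_estimator M X b \<theta>hat"
    and info_max: "\<And>i \<omega>. i \<ge> 1 \<Longrightarrow> \<omega> \<in> space M \<Longrightarrow>
          is_arg_max (item_info (\<theta>hat i \<omega>)) (\<lambda>v. v \<in> B) (b (Suc i) \<omega>)"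
begin

section \<open>Filtration and measurability of the test data\<close>

abbreviation F :: "nat \<Rightarrow> 'w measure" where
  "F \<equiv> response_filtration M X"

abbreviation S :: "nat \<Rightarrow> 'w \<Rightarrow> real" where
  "S n \<omega> \<equiv> score b X n \<theta> \<omega>"

lemma measurable_X: "1 \<le> i \<Longrightarrow> X i \<in> M \<rightarrow>\<^sub>M count_space UNIV"
  using responses by (simp add: nrm_responses_def)

lemma space_F [simp]: "space (F n) = space M"
  by (auto simp: response_filtration_def intro!: space_measure_of)

lemma sets_F:
  "sets (F n) = sigma_sets (space M) {{\<omega> \<in> space M. X i \<omega> = k} | i k. i \<in> {1..n}}"
  by (auto simp: response_filtration_def intro!: sets_measure_of)

lemma sets_F_mono: "m \<le> n \<Longrightarrow> sets (F m) \<subseteq> sets (F n)"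
  unfolding sets_F by (intro sigma_sets_mono') force

lemma subalgebra_F: "subalgebra M (F n)"
proof -
  have "{\<omega> \<in> space M. X i \<omega> = k} \<in> sets M" if "1 \<le> i" for i k
    using measurable_X[OF that] by simp
  then have "sets (F n) \<subseteq> sets M"
    unfolding sets_F by (intro sets.sigma_sets_subset) auto
  then show ?thesis by (simp add: subalgebra_def)
qed

lemma measurable_F_M: "f \<in> F n \<rightarrow>\<^sub>M N \<Longrightarrow> f \<in> M \<rightarrow>\<^sub>M N"
  using subalgebra_F by (rule measurable_from_subalg)

lemma measurable_F_mono: "f \<in> F m \<rightarrow>\<^sub>M N \<Longrightarrow> m \<le> n \<Longrightarrow> f \<in> F n \<rightarrow>\<^sub>M N"
  using sets_F_mono[of m n] by (intro measurable_from_subalg[of "F n" "F m"]) (auto simp: subalgebra_def)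

lemma measurable_X_F: "1 \<le> i \<Longrightarrow> i \<le> n \<Longrightarrow> X i \<in> F n \<rightarrow>\<^sub>M count_space UNIV"
  by (subst measurable_count_space_eq2) (auto simp: vimage_def Int_def sets_F conj_commute
      intro!: sigma_sets.Basic)

lemma measurable_b_F: "b (Suc n) \<in> F n \<rightarrow>\<^sub>M borel"
  using strategy by (simp add: item_selection_strategy_def)

lemma measurable_b: "1 \<le> i \<Longrightarrow> b i \<in> borel_measurable M"
  using measurable_F_M[OF measurable_b_F, of "i - 1"] by simp

lemma b_in_B: "1 \<le> i \<Longrightarrow> \<omega> \<in> space M \<Longrightarrow> b i \<omega> \<in> B"
  using strategy by (simp add: item_selection_strategy_def)

lemma measurable_\<theta>hat: "1 \<le> n \<Longrightarrow> \<theta>hat n \<in> borel_measurable M"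
  using estimator by (auto simp: ability_estimator_def intro: measurable_F_M)

lemma \<theta>hat_root:
  "1 \<le> n \<Longrightarrow> \<omega> \<in> space M \<Longrightarrow> score b X n t \<omega> = 0 \<Longrightarrow> score b X n (\<theta>hat n \<omega>) \<omega> = 0"
  using estimator unfolding ability_estimator_def by blast

text \<open>The sigma-algebra \<open>N\<close> is left open because two are used: \<open>F n\<close>
  with the constant ability \<open>\<theta>\<close>, and \<open>M\<close> with the random
  estimate.\<close>

lemma measurable_score:
  assumes "f \<in> borel_measurable N" "\<And>i. i \<in> {1..n} \<Longrightarrow> b i \<in> borel_measurable N"
    "\<And>i. i \<in> {1..n} \<Longrightarrow> X i \<in> N \<rightarrow>\<^sub>M count_space UNIV"
  shows "(\<lambda>\<omega>. score b X n (f \<omega>) \<omega>) \<in> borel_measurable N"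
  unfolding score_def
  by (intro borel_measurable_sum measurable_compose_countable[OF measurable_item_score]) (use assms in auto)

lemma measurable_S_F: "S n \<in> borel_measurable (F n)"
proof (rule measurable_score)
  fix i assume "i \<in> {1..n}"
  then obtain j where "i = Suc j" "j \<le> n" by (cases i) auto
  then show "b i \<in> borel_measurable (F n)"
    using measurable_F_mono[OF measurable_b_F, of j n] by simp
qed (simp_all add: measurable_X_F)

lemma measurable_S [measurable]: "S n \<in> borel_measurable M"
  by (rule measurable_F_M[OF measurable_S_F])

lemma measurable_info:
  assumes "f \<in> borel_measurable M"
  shows "(\<lambda>\<omega>. info b n (f \<omega>) \<omega>) \<in> borel_measurable M"
  unfolding info_def
proof (rule borel_measurable_sum)
  fix i assume "i \<in> {1..n}"
  then show "(\<lambda>\<omega>. item_info (f \<omega>) (b i \<omega>)) \<in> borel_measurable M"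
    by (intro measurable_item_info assms measurable_b) simp
qed

section \<open>Averaging over the next response\<close>

text \<open>
  The model enters only here: in expectations, the response may be averaged out over the category
  probabilities, given the past.  The weight \<open>W\<close> carries the dependence on the past.
\<close>

lemma integral_response_real:
  fixes W :: "'k option \<Rightarrow> 'w \<Rightarrow> real"
  assumes meas: "\<And>k. W k \<in> borel_measurable (F n)"
    and bound: "\<And>k \<omega>. \<omega> \<in> space M \<Longrightarrow> \<bar>W k \<omega>\<bar> \<le> C"
  shows "expectation (\<lambda>\<omega>. W (X (Suc n) \<omega>) \<omega>)
    = expectation (\<lambda>\<omega>. \<Sum>k\<in>UNIV. nrm_prob \<theta> (b (Suc n) \<omega>) k * W k \<omega>)"
proof -
  interpret sub: finite_measure_subalgebra M "F n"
    by unfold_locales (rule subalgebra_F)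
  have [measurable]: "W k \<in> borel_measurable M" for k
    by (rule measurable_F_M[OF meas])
  have [measurable]: "X (Suc n) \<in> M \<rightarrow>\<^sub>M count_space UNIV"
    by (rule measurable_X) simp
  have [measurable]: "(\<lambda>\<omega>. nrm_prob \<theta> (b (Suc n) \<omega>) k) \<in> borel_measurable M" for k
    by (intro measurable_nrm_prob borel_measurable_const measurable_b) simp
  have C: "0 \<le> C"
    using not_empty bound by (meson abs_ge_zero all_not_in_conv order_trans)
  let ?I = "\<lambda>k. indicator {\<omega> \<in> space M. X (Suc n) \<omega> = k} :: 'w \<Rightarrow> real"
  have int: "integrable M (\<lambda>\<omega>. W k \<omega> * ?I k \<omega>)" for k
    using bound C by (intro integrable_const_bound[of _ C]) (auto simp: indicator_def)
  \<comment> \<open>Since \<open>W k\<close> is \<open>F n\<close>-measurable, the indicator of a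
    response may be replaced under the integral by its conditional expectation, which the model
    equates with the category probability.\<close>
  note ce = sub.real_cond_exp_intg[OF int meas]
  have AE: "AE \<omega> in M. W k \<omega> * real_cond_exp M (F n) (?I k) \<omega> = nrm_prob \<theta> (b (Suc n) \<omega>) k * W k \<omega>" for k
  proof -
    have "AE \<omega> in M. real_cond_exp M (F n) (?I k) \<omega> = nrm_prob \<theta> (b (Suc n) \<omega>) k"
      using responses[unfolded nrm_responses_def, THEN conjunct2, rule_format, of "Suc n" k] by simp
    then show ?thesis by eventually_elim simp
  qed
  have int2: "integrable M (\<lambda>\<omega>. nrm_prob \<theta> (b (Suc n) \<omega>) k * W k \<omega>)" for k
    using ce(1)[of k] by (rule integrable_cong_AE_imp) (use AE in auto)
  have "expectation (\<lambda>\<omega>. W (X (Suc n) \<omega>) \<omega>) = expectation (\<lambda>\<omega>. \<Sum>k\<in>UNIV. W k \<omega> * ?I k \<omega>)"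
  proof (rule Bochner_Integration.integral_cong[OF refl])
    fix \<omega> assume "\<omega> \<in> space M"
    then have "(\<Sum>k\<in>UNIV. W k \<omega> * ?I k \<omega>) = (\<Sum>k\<in>UNIV. if k = X (Suc n) \<omega> then W k \<omega> else 0)"
      by (intro sum.cong) auto
    then show "W (X (Suc n) \<omega>) \<omega> = (\<Sum>k\<in>UNIV. W k \<omega> * ?I k \<omega>)" by simp
  qed
  also have "\<dots> = (\<Sum>k\<in>UNIV. expectation (\<lambda>\<omega>. W k \<omega> * ?I k \<omega>))"
    by (rule Bochner_Integration.integral_sum) (rule int)
  also have "\<dots> = (\<Sum>k\<in>UNIV. expectation (\<lambda>\<omega>. nrm_prob \<theta> (b (Suc n) \<omega>) k * W k \<omega>))"
  proof (rule sum.cong[OF refl])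
    fix k
    have "expectation (\<lambda>\<omega>. W k \<omega> * ?I k \<omega>) = expectation (\<lambda>\<omega>. W k \<omega> * real_cond_exp M (F n) (?I k) \<omega>)"
      by (rule ce(2)[symmetric]) measurable
    also have "\<dots> = expectation (\<lambda>\<omega>. nrm_prob \<theta> (b (Suc n) \<omega>) k * W k \<omega>)"
      by (rule integral_cong_AE) (use AE in auto)
    finally show "expectation (\<lambda>\<omega>. W k \<omega> * ?I k \<omega>)
        = expectation (\<lambda>\<omega>. nrm_prob \<theta> (b (Suc n) \<omega>) k * W k \<omega>)" .
  qed
  also have "\<dots> = expectation (\<lambda>\<omega>. \<Sum>k\<in>UNIV. nrm_prob \<theta> (b (Suc n) \<omega>) k * W k \<omega>)"
    by (rule Bochner_Integration.integral_sum[symmetric]) (rule int2)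
  finally show ?thesis .
qed

text \<open>Real and imaginary parts are reduced to the real case, because the model is stated with
  the real conditional expectation.\<close>

lemma integral_response_complex:
  fixes W :: "'k option \<Rightarrow> 'w \<Rightarrow> complex"
  assumes meas: "\<And>k. W k \<in> borel_measurable (F n)"
    and bound: "\<And>k \<omega>. \<omega> \<in> space M \<Longrightarrow> cmod (W k \<omega>) \<le> C"
  shows "expectation (\<lambda>\<omega>. W (X (Suc n) \<omega>) \<omega>)
    = expectation (\<lambda>\<omega>. \<Sum>k\<in>UNIV. complex_of_real (nrm_prob \<theta> (b (Suc n) \<omega>) k) * W k \<omega>)"
proof -
  have [measurable]: "W k \<in> borel_measurable M" for k
    by (rule measurable_F_M[OF meas])
  have [measurable]: "X (Suc n) \<in> M \<rightarrow>\<^sub>M count_space UNIV"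
    by (rule measurable_X) simp
  have [measurable]: "(\<lambda>\<omega>. nrm_prob \<theta> (b (Suc n) \<omega>) k) \<in> borel_measurable M" for k
    by (intro measurable_nrm_prob borel_measurable_const measurable_b) simp
  have [measurable]: "(\<lambda>\<omega>. W (X (Suc n) \<omega>) \<omega>) \<in> borel_measurable M"
    by (rule measurable_compose_countable) measurable
  have i1: "integrable M (\<lambda>\<omega>. W (X (Suc n) \<omega>) \<omega>)"
    using bound by (intro integrable_const_bound[of _ C]) auto
  have i2: "integrable M (\<lambda>\<omega>. \<Sum>k\<in>UNIV. complex_of_real (nrm_prob \<theta> (b (Suc n) \<omega>) k) * W k \<omega>)"
  proof (rule integrable_const_bound[of _ C], rule AE_I2)
    fix \<omega> assume \<omega>: "\<omega> \<in> space M"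
    have "cmod (\<Sum>k\<in>UNIV. complex_of_real (nrm_prob \<theta> (b (Suc n) \<omega>) k) * W k \<omega>)
        \<le> (\<Sum>k\<in>UNIV. nrm_prob \<theta> (b (Suc n) \<omega>) k * C)"
      using bound[OF \<omega>] by (intro sum_norm_le) (auto simp: norm_mult intro!: mult_left_mono)
    then show "cmod (\<Sum>k\<in>UNIV. complex_of_real (nrm_prob \<theta> (b (Suc n) \<omega>) k) * W k \<omega>) \<le> C"
      by (simp add: sum_nrm_prob flip: sum_distrib_right)
  qed measurable
  have "expectation (\<lambda>\<omega>. Re (W (X (Suc n) \<omega>) \<omega>))
      = expectation (\<lambda>\<omega>. \<Sum>k\<in>UNIV. nrm_prob \<theta> (b (Suc n) \<omega>) k * Re (W k \<omega>))"
    by (rule integral_response_real[where C = C])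
       (use bound meas in \<open>auto intro: order_trans[OF abs_Re_le_cmod] borel_measurable_Re\<close>)
  moreover have "expectation (\<lambda>\<omega>. Im (W (X (Suc n) \<omega>) \<omega>))
      = expectation (\<lambda>\<omega>. \<Sum>k\<in>UNIV. nrm_prob \<theta> (b (Suc n) \<omega>) k * Im (W k \<omega>))"
    by (rule integral_response_real[where C = C])
       (use bound meas in \<open>auto intro: order_trans[OF abs_Im_le_cmod] borel_measurable_Im\<close>)
  ultimately show ?thesis
    unfolding complex_eq_iff integral_Re[OF i1, symmetric] integral_Im[OF i1, symmetric]
      integral_Re[OF i2, symmetric] integral_Im[OF i2, symmetric] by simp
qed

section \<open>Uniform bounds on \<open>B\<close> and the maximal information\<close>

abbreviation J :: real where
  "J \<equiv> max_info B \<theta>"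

lemma score_Suc: "score b X (Suc n) t \<omega> = score b X n t \<omega> + item_score t (b (Suc n) \<omega>) (X (Suc n) \<omega>)"
  by (simp add: score_def)

text \<open>Such a bound exists by compactness, as the next lemma shows. Positivity is demanded
  because \<open>K\<^sup>2\<close> occurs as a divisor.\<close>

definition K :: real where
  "K = (SOME K. 0 < K \<and> (\<forall>v\<in>B. \<forall>k. \<bar>item_score \<theta> v k\<bar> \<le> K))"

text \<open>The sum of the absolute scores over all categories is continuous on the compact set
  \<open>B\<close>, and its maximum bounds every category at once.\<close>

lemma K_pos: "0 < K" and item_score_le_K: "v \<in> B \<Longrightarrow> \<bar>item_score \<theta> v k\<bar> \<le> K"
proof -
  have "continuous_on B (\<lambda>v. \<Sum>k\<in>UNIV. \<bar>item_score \<theta> v k\<bar>)"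
    by (intro continuous_on_sum continuous_on_rabs continuous_on_item_score
        continuous_on_const continuous_on_id)
  from continuous_attains_sup[OF compact_B B_nonempty this]
  obtain C where C: "\<And>v. v \<in> B \<Longrightarrow> (\<Sum>k\<in>UNIV. \<bar>item_score \<theta> v k\<bar>) \<le> C" by blast
  \<comment> \<open>Passing from \<open>C\<close> to \<open>\<bar>C\<bar> + 1\<close> makes the
    bound strictly positive.\<close>
  have "\<bar>item_score \<theta> v k\<bar> \<le> \<bar>C\<bar> + 1" if "v \<in> B" for v k
    using member_le_sum[of k UNIV "\<lambda>k. \<bar>item_score \<theta> v k\<bar>"] C[OF that] by simp
  then have "\<exists>K. 0 < K \<and> (\<forall>v\<in>B. \<forall>k. \<bar>item_score \<theta> v k\<bar> \<le> K)"
    by (intro exI[of _ "\<bar>C\<bar> + 1"]) auto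
  from someI_ex[OF this] show "0 < K" "v \<in> B \<Longrightarrow> \<bar>item_score \<theta> v k\<bar> \<le> K"
    unfolding K_def by blast+
qed

lemma item_info_le: "v \<in> B \<Longrightarrow> item_info \<theta> v \<le> K\<^sup>2"
proof -
  assume v: "v \<in> B"
  have "item_info \<theta> v \<le> (\<Sum>k\<in>UNIV. nrm_prob \<theta> v k * K\<^sup>2)"
    unfolding item_info_eq using item_score_le_K[OF v] K_pos
    by (intro sum_mono mult_left_mono) (auto simp: power2_le_iff_abs_le)
  then show ?thesis by (simp add: sum_nrm_prob flip: sum_distrib_right)
qed

lemma bdd_above_item_info: "bdd_above (item_info \<theta> ` B)"
  using item_info_le by (rule bdd_aboveI2)

lemma item_info_le_J: "v \<in> B \<Longrightarrow> item_info \<theta> v \<le> J"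
  unfolding max_info_def by (intro cSUP_upper bdd_above_item_info)

text \<open>Compactness turns the supremum into a maximum. The maximizer yields positivity of
  \<open>J\<close> and later serves as competitor of the selected items.\<close>

lemma J_attained: "\<exists>v\<in>B. item_info \<theta> v = J"
proof -
  obtain v where v: "v \<in> B" "\<And>w. w \<in> B \<Longrightarrow> item_info \<theta> w \<le> item_info \<theta> v"
    using continuous_attains_sup[OF compact_B B_nonempty
        continuous_on_item_info[OF continuous_on_const continuous_on_id]] by blast
  from v(2) have "J \<le> item_info \<theta> v"
    unfolding max_info_def by (intro cSUP_least B_nonempty)
  then show ?thesis using v item_info_le_J[of v] by (intro bexI[of _ v]) auto
qed

lemma J_pos: "0 < J"
  using J_attained item_info_pos B_admissible by metis

lemma J_le: "J \<le> K\<^sup>2"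
  using J_attained item_info_le by metis

section \<open>Growth of the score at the true ability\<close>

lemma abs_S_le: "\<omega> \<in> space M \<Longrightarrow> \<bar>S n \<omega>\<bar> \<le> n * K"
proof (induction n)
  case 0
  then show ?case by (simp add: score_def)
next
  case (Suc n)
  have "\<bar>item_score \<theta> (b (Suc n) \<omega>) (X (Suc n) \<omega>)\<bar> \<le> K"
    using Suc.prems by (intro item_score_le_K b_in_B) auto
  with Suc show ?case unfolding score_Suc by (auto simp: algebra_simps intro: order_trans[OF abs_triangle_ineq])
qed

lemma integrable_S2: "integrable M (\<lambda>\<omega>. (S n \<omega>)\<^sup>2)"
  by (rule integrable_const_bound[of _ "(n * K)\<^sup>2"])
     (use K_pos in \<open>auto simp: power2_le_iff_abs_le intro!: AE_I2 abs_S_le\<close>)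

text \<open>Martingale increments are orthogonal to the past, so second moments add up, and each
  increment contributes at most \<open>K\<^sup>2\<close>.\<close>

lemma expectation_S2_le: "expectation (\<lambda>\<omega>. (S n \<omega>)\<^sup>2) \<le> n * K\<^sup>2"
proof (induction n)
  case 0
  then show ?case by (simp add: score_def)
next
  case (Suc n)
  define d where "d \<omega> = item_score \<theta> (b (Suc n) \<omega>) (X (Suc n) \<omega>)" for \<omega>
  have d: "\<bar>d \<omega>\<bar> \<le> K" if "\<omega> \<in> space M" for \<omega>
    using that unfolding d_def by (intro item_score_le_K b_in_B) auto
  have S_eq: "S (Suc n) \<omega> = S n \<omega> + d \<omega>" for \<omega>
    by (simp add: score_Suc d_def)
  have [measurable]: "d \<in> borel_measurable M"
  proof -
    have "d = (\<lambda>\<omega>. S (Suc n) \<omega> - S n \<omega>)" by (simp add: S_eq)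
    then show ?thesis by simp
  qed
  have int: "integrable M (\<lambda>\<omega>. S n \<omega> * d \<omega>)"
    by (rule integrable_const_bound[of _ "(n * K) * K"])
       (use K_pos in \<open>auto simp: abs_mult intro!: AE_I2 mult_mono abs_S_le d\<close>)
  have int2: "integrable M (\<lambda>\<omega>. (d \<omega>)\<^sup>2)"
    by (rule integrable_const_bound[of _ "K\<^sup>2"])
       (use K_pos in \<open>auto simp: power2_le_iff_abs_le intro!: AE_I2 d\<close>)
  \<comment> \<open>The past score and the next item are known from the first \<open>n\<close>
    responses, so averaging over the next response leaves \<open>S n\<close> times a centred
    sum.\<close>
  have "expectation (\<lambda>\<omega>. S n \<omega> * d \<omega>)
      = expectation (\<lambda>\<omega>. \<Sum>k\<in>UNIV. nrm_prob \<theta> (b (Suc n) \<omega>) k * (S n \<omega> * item_score \<theta> (b (Suc n) \<omega>) k))"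
    unfolding d_def
  proof (rule integral_response_real)
    show "(\<lambda>\<omega>. S n \<omega> * item_score \<theta> (b (Suc n) \<omega>) k) \<in> borel_measurable (F n)" for k
      by (intro borel_measurable_times measurable_S_F measurable_item_score measurable_b_F) simp
    show "\<bar>S n \<omega> * item_score \<theta> (b (Suc n) \<omega>) k\<bar> \<le> (n * K) * K" if "\<omega> \<in> space M" for k \<omega>
      unfolding abs_mult using that K_pos by (intro mult_mono abs_S_le item_score_le_K b_in_B) auto
  qed
  also have "\<dots> = expectation (\<lambda>\<omega>. S n \<omega> *
      (\<Sum>k\<in>UNIV. nrm_prob \<theta> (b (Suc n) \<omega>) k * item_score \<theta> (b (Suc n) \<omega>) k))"
    by (simp add: sum_distrib_left mult_ac)
  finally have orth: "expectation (\<lambda>\<omega>. S n \<omega> * d \<omega>) = 0"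
    by (simp add: sum_nrm_prob_score)
  have "expectation (\<lambda>\<omega>. (S (Suc n) \<omega>)\<^sup>2)
      = expectation (\<lambda>\<omega>. (S n \<omega>)\<^sup>2 + (d \<omega>)\<^sup>2 + 2 * (S n \<omega> * d \<omega>))"
    by (simp add: S_eq power2_sum mult_ac)
  also have "\<dots> = expectation (\<lambda>\<omega>. (S n \<omega>)\<^sup>2) + expectation (\<lambda>\<omega>. (d \<omega>)\<^sup>2)"
    using int int2 integrable_S2[of n] orth by simp
  also have "expectation (\<lambda>\<omega>. (d \<omega>)\<^sup>2) \<le> expectation (\<lambda>\<omega>. K\<^sup>2)"
    by (rule integral_mono) (use int2 K_pos in \<open>auto simp: power2_le_iff_abs_le intro!: d\<close>)
  finally show ?case using Suc by (simp add: prob_space algebra_simps)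
qed

text \<open>Chebyshev's inequality: the second moment grows linearly, the squared threshold
  quadratically.\<close>

lemma prob_S_large:
  fixes \<delta> :: real
  assumes "0 < \<delta>"
  shows "(\<lambda>n. prob {\<omega>\<in>space M. \<bar>S n \<omega>\<bar> \<ge> n * \<delta>}) \<longlonglongrightarrow> 0"
proof (rule tendsto_sandwich[OF _ _ tendsto_const])
  have le: "prob {\<omega>\<in>space M. \<bar>S n \<omega>\<bar> \<ge> n * \<delta>} \<le> K\<^sup>2 / \<delta>\<^sup>2 / n" if "0 < n" for n
  proof -
    have "prob {\<omega>\<in>space M. \<bar>S n \<omega>\<bar> \<ge> n * \<delta>} \<le> expectation (\<lambda>\<omega>. (S n \<omega>)\<^sup>2) / (n * \<delta>)\<^sup>2"
      by (rule second_moment_method) (use that assms integrable_S2 in auto)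
    also have "\<dots> \<le> (n * K\<^sup>2) / (n * \<delta>)\<^sup>2"
      by (intro divide_right_mono expectation_S2_le) simp
    also have "\<dots> = K\<^sup>2 / \<delta>\<^sup>2 / n"
      using that by (simp add: power2_eq_square field_simps)
    finally show ?thesis .
  qed
  then show "\<forall>\<^sub>F n in sequentially. prob {\<omega>\<in>space M. \<bar>S n \<omega>\<bar> \<ge> n * \<delta>} \<le> K\<^sup>2 / \<delta>\<^sup>2 / n"
    by (intro eventually_sequentiallyI[of 1]) auto
  show "(\<lambda>n. K\<^sup>2 / \<delta>\<^sup>2 / real n) \<longlonglongrightarrow> 0"
    by (rule lim_const_over_n)
qed simp

section \<open>Existence and location of the root\<close>

lemma continuous_on_score: "continuous_on A (\<lambda>t. score b X n t \<omega>)"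
  unfolding score_def by (intro continuous_intros)

lemma score_strict_antimono:
  assumes "1 \<le> n" "\<omega> \<in> space M" "s < t"
  shows "score b X n t \<omega> < score b X n s \<omega>"
  unfolding score_def using assms
  by (intro sum_strict_mono) (auto simp: item_score_def intro!: mean_slope_strict_mono B_admissible b_in_B)

text \<open>Demanding an actual root excludes the values of the initialization rule, which may be
  close to \<open>\<theta>\<close> by chance.\<close>

definition located :: "real \<Rightarrow> nat \<Rightarrow> 'w \<Rightarrow> bool" where
  "located \<epsilon> n \<omega> \<longleftrightarrow> score b X n (\<theta>hat n \<omega>) \<omega> = 0 \<and> \<bar>\<theta>hat n \<omega> - \<theta>\<bar> < \<epsilon>"

lemma located_sets: "1 \<le> n \<Longrightarrow> {\<omega>\<in>space M. \<not> located \<epsilon> n \<omega>} \<in> sets M"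
proof -
  assume n: "1 \<le> n"
  have [measurable]: "\<theta>hat n \<in> borel_measurable M"
    by (rule measurable_\<theta>hat[OF n])
  have [measurable]: "(\<lambda>\<omega>. score b X n (\<theta>hat n \<omega>) \<omega>) \<in> borel_measurable M"
    by (rule measurable_score) (auto intro: measurable_b measurable_X measurable_\<theta>hat n)
  show ?thesis unfolding located_def by measurable
qed

text \<open>If \<open>\<bar>S n \<omega>\<bar> < n * \<delta>\<close> for a suitable
  \<open>\<delta>\<close>, the score is positive at \<open>\<theta> - \<epsilon>\<close> and
  negative at \<open>\<theta> + \<epsilon>\<close>. Hence a root exists, the estimate is a root, and
  monotonicity places it between the two points.\<close>

lemma prob_not_located:
  assumes \<epsilon>: "0 < \<epsilon>"
  shows "(\<lambda>n. prob {\<omega>\<in>space M. \<not> located \<epsilon> n \<omega>}) \<longlonglongrightarrow> 0"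
proof -
  \<comment> \<open>The positive difference of mean slopes attains its minimum on \<open>B\<close>,
    which gives one bound for all items.\<close>
  have "\<exists>\<delta>>0. \<forall>v\<in>B. \<delta> \<le> mean_slope t v - mean_slope s v" if "s < t" for s t
  proof -
    obtain w where w: "w \<in> B"
      "\<And>v. v \<in> B \<Longrightarrow> mean_slope t w - mean_slope s w \<le> mean_slope t v - mean_slope s v"
      using continuous_attains_inf[OF compact_B B_nonempty continuous_on_diff[OF
          continuous_on_mean_slope[OF continuous_on_const continuous_on_id]
          continuous_on_mean_slope[OF continuous_on_const continuous_on_id]]] by blast
    then show ?thesis
      using mean_slope_strict_mono[OF B_admissible[OF w(1)] that]
      by (intro exI[of _ "mean_slope t w - mean_slope s w"]) auto
  qed
  note gap = this
  obtain \<delta>1 where \<delta>1: "\<delta>1 > 0" "\<And>v. v \<in> B \<Longrightarrow> \<delta>1 \<le> mean_slope (\<theta> + \<epsilon>) v - mean_slope \<theta> v"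
    using gap[of \<theta> "\<theta> + \<epsilon>"] \<epsilon> by auto
  obtain \<delta>2 where \<delta>2: "\<delta>2 > 0" "\<And>v. v \<in> B \<Longrightarrow> \<delta>2 \<le> mean_slope \<theta> v - mean_slope (\<theta> - \<epsilon>) v"
    using gap[of "\<theta> - \<epsilon>" \<theta>] \<epsilon> by auto
  define \<delta> where "\<delta> = min \<delta>1 \<delta>2"
  have \<delta>: "0 < \<delta>" using \<delta>1 \<delta>2 by (simp add: \<delta>_def)
  have loc: "located \<epsilon> n \<omega>" if n: "1 \<le> n" and \<omega>: "\<omega> \<in> space M" and small: "\<bar>S n \<omega>\<bar> < n * \<delta>" for n \<omega>
  proof -
    have B: "b i \<omega> \<in> B" if "i \<in> {1..n}" for i
      using that \<omega> by (intro b_in_B) auto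
    have "score b X n (\<theta> + \<epsilon>) \<omega> - S n \<omega> = - (\<Sum>i=1..n. mean_slope (\<theta> + \<epsilon>) (b i \<omega>) - mean_slope \<theta> (b i \<omega>))"
      by (simp add: score_def item_score_def sum_subtractf)
    also have "\<dots> \<le> - (\<Sum>i=1..n. \<delta>)"
      using \<delta>1(2)[OF B] by (intro le_imp_neg_le sum_mono) (auto simp: \<delta>_def min_le_iff_disj)
    finally have neg: "score b X n (\<theta> + \<epsilon>) \<omega> < 0" using small by simp
    have "score b X n (\<theta> - \<epsilon>) \<omega> - S n \<omega> = (\<Sum>i=1..n. mean_slope \<theta> (b i \<omega>) - mean_slope (\<theta> - \<epsilon>) (b i \<omega>))"
      by (simp add: score_def item_score_def sum_subtractf)
    also have "\<dots> \<ge> (\<Sum>i=1..n. \<delta>)"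
      using \<delta>2(2)[OF B] by (intro sum_mono) (auto simp: \<delta>_def min_le_iff_disj)
    finally have pos: "score b X n (\<theta> - \<epsilon>) \<omega> > 0" using small by simp
    obtain t where t: "score b X n t \<omega> = 0"
      using IVT2'[of "\<lambda>t. score b X n t \<omega>" "\<theta> + \<epsilon>" 0 "\<theta> - \<epsilon>"] neg pos \<epsilon> continuous_on_score by auto
    have root: "score b X n (\<theta>hat n \<omega>) \<omega> = 0"
      by (rule \<theta>hat_root[OF n \<omega> t])
    have "\<theta>hat n \<omega> < \<theta> + \<epsilon>"
      using score_strict_antimono[OF n \<omega>, of "\<theta> + \<epsilon>" "\<theta>hat n \<omega>"] root neg
      by (cases "\<theta>hat n \<omega> = \<theta> + \<epsilon>") force+
    moreover have "\<theta> - \<epsilon> < \<theta>hat n \<omega>"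
      using score_strict_antimono[OF n \<omega>, of "\<theta>hat n \<omega>" "\<theta> - \<epsilon>"] root pos
      by (cases "\<theta>hat n \<omega> = \<theta> - \<epsilon>") force+
    ultimately show ?thesis using root by (auto simp: located_def)
  qed
  show ?thesis
  proof (rule tendsto_sandwich[OF _ _ tendsto_const prob_S_large[OF \<delta>]])
    show "\<forall>\<^sub>F n in sequentially. prob {\<omega>\<in>space M. \<not> located \<epsilon> n \<omega>} \<le> prob {\<omega>\<in>space M. \<bar>S n \<omega>\<bar> \<ge> n * \<delta>}"
      using loc by (intro eventually_sequentiallyI[of 1] finite_measure_mono) (auto simp: not_less[symmetric])
  qed simp
qed

section \<open>Asymptotic normality\<close>

text \<open>Uniform continuity on a compact product. The unit ball around \<open>\<theta>\<close>
  supplies a compact range of abilities, whence the cap at \<open>1\<close> on the radius.\<close>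

lemma item_info_close:
  assumes "0 < \<eta>"
  shows "\<exists>\<delta>>0. \<forall>v\<in>B. \<forall>t. \<bar>t - \<theta>\<bar> < \<delta> \<longrightarrow> \<bar>item_info t v - item_info \<theta> v\<bar> \<le> \<eta>"
proof -
  have "uniformly_continuous_on (cball \<theta> 1 \<times> B) (\<lambda>x. item_info (fst x) (snd x))"
    by (intro compact_uniformly_continuous compact_Times compact_cball compact_B
        continuous_on_item_info continuous_on_fst continuous_on_snd continuous_on_id)
  then obtain d where d: "0 < d" "\<And>x y. x \<in> cball \<theta> 1 \<times> B \<Longrightarrow> y \<in> cball \<theta> 1 \<times> B \<Longrightarrow> dist y x < d \<Longrightarrow>
      dist (item_info (fst y) (snd y)) (item_info (fst x) (snd x)) < \<eta>"
    unfolding uniformly_continuous_on_def using assms by meson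
  have "\<bar>item_info t v - item_info \<theta> v\<bar> \<le> \<eta>" if "v \<in> B" "\<bar>t - \<theta>\<bar> < min d 1" for v t
  proof -
    have "dist (item_info (fst (t, v)) (snd (t, v))) (item_info (fst (\<theta>, v)) (snd (\<theta>, v))) < \<eta>"
      by (rule d(2)) (use that in \<open>auto simp: dist_Pair_Pair dist_real_def abs_minus_commute\<close>)
    then show ?thesis by (simp add: dist_real_def)
  qed
  then show ?thesis using d(1) by (intro exI[of _ "min d 1"]) auto
qed

section \<open>Information lost by selecting items at the estimate\<close>

text \<open>The index counts the responses available when the item is chosen, so the sum over
  \<open>i < n\<close> covers items \<open>1\<close> to \<open>n\<close>.\<close>

definition gap :: "nat \<Rightarrow> 'w \<Rightarrow> real" where
  "gap n \<omega> = J - item_info \<theta> (b (Suc n) \<omega>)"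

lemma gap_nonneg: "\<omega> \<in> space M \<Longrightarrow> 0 \<le> gap n \<omega>"
  unfolding gap_def using item_info_le_J[of "b (Suc n) \<omega>"] b_in_B[of "Suc n" \<omega>] by simp

lemma gap_le: "gap n \<omega> \<le> K\<^sup>2"
  unfolding gap_def using item_info_nonneg[of \<theta> "b (Suc n) \<omega>"] J_le by simp

lemma measurable_gap [measurable]: "gap n \<in> borel_measurable M"
proof -
  have "(\<lambda>\<omega>. item_info \<theta> (b (Suc n) \<omega>)) \<in> borel_measurable M"
    by (intro measurable_item_info borel_measurable_const measurable_b) simp
  then show ?thesis unfolding gap_def by simp
qed

lemma integrable_gap: "integrable M (gap n)"
  using gap_nonneg gap_le by (intro integrable_const_bound[of _ "K\<^sup>2"]) (auto intro!: AE_I2)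

text \<open>At the estimate the selected item is at least as informative as a maximizer
  \<open>w\<close> at \<open>\<theta>\<close>. Moving the ability from the estimate to
  \<open>\<theta>\<close> changes either information by at most \<open>e / 4\<close>, so the gap is
  at most \<open>e / 2\<close> when the estimate is close. Otherwise it is at most
  \<open>K\<^sup>2\<close>, on an event of small probability.\<close>

lemma expectation_gap: "(\<lambda>n. expectation (gap n)) \<longlonglongrightarrow> 0"
proof (rule LIMSEQ_I)
  fix e :: real assume e: "0 < e"
  obtain \<delta> where \<delta>: "0 < \<delta>"
    "\<And>v t. v \<in> B \<Longrightarrow> \<bar>t - \<theta>\<bar> < \<delta> \<Longrightarrow> \<bar>item_info t v - item_info \<theta> v\<bar> \<le> e / 4"
    using item_info_close[of "e / 4"] e by fastforce
  obtain N where N: "\<And>n. n \<ge> N \<Longrightarrow> prob {\<omega>\<in>space M. \<not> located \<delta> n \<omega>} < e / (2 * K\<^sup>2)"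
    using LIMSEQ_D[OF prob_not_located[OF \<delta>(1)], of "e / (2 * K\<^sup>2)"] e K_pos by auto
  obtain w where w: "w \<in> B" "item_info \<theta> w = J" using J_attained by blast
  \<comment> \<open>The bound \<open>1\<close> on \<open>n\<close> is there because the estimator
    and the maximizing choice are specified only from index \<open>1\<close> on.\<close>
  have "norm (expectation (gap n) - 0) < e" if n: "n \<ge> max N 1" for n
  proof -
    let ?A = "{\<omega>\<in>space M. \<not> located \<delta> n \<omega>}"
    have A: "?A \<in> sets M" using n by (intro located_sets) simp
    have int: "integrable M (\<lambda>\<omega>. K\<^sup>2 * indicator ?A \<omega> :: real)"
      using A by (intro integrable_mult_right integrable_real_indicator) (auto simp: emeasure_eq_measure)
    have "expectation (gap n) \<le> expectation (\<lambda>\<omega>. e / 2 + K\<^sup>2 * indicator ?A \<omega>)"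
    proof (rule integral_mono)
      fix \<omega> assume \<omega>: "\<omega> \<in> space M"
      show "gap n \<omega> \<le> e / 2 + K\<^sup>2 * indicator ?A \<omega>"
      proof (cases "located \<delta> n \<omega>")
        case True
        have b: "b (Suc n) \<omega> \<in> B" using \<omega> by (intro b_in_B) auto
        have t: "\<bar>\<theta>hat n \<omega> - \<theta>\<bar> < \<delta>" using True by (simp add: located_def)
        have "\<not> item_info (\<theta>hat n \<omega>) (b (Suc n) \<omega>) < item_info (\<theta>hat n \<omega>) w"
          using info_max[OF _ \<omega>, of n] n w(1) unfolding is_arg_max_def by fastforce
        then have "gap n \<omega> \<le> e / 2"
          using \<delta>(2)[OF b t] \<delta>(2)[OF w(1) t] w(2) unfolding gap_def by linarith
        then show ?thesis using True by simp
      next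
        case False
        then show ?thesis using gap_le[of n \<omega>] \<omega> e by simp
      qed
    next
      show "integrable M (\<lambda>\<omega>. e / 2 + K\<^sup>2 * indicator ?A \<omega>)"
        using int by (intro Bochner_Integration.integrable_add) auto
    qed (rule integrable_gap)
    also have "\<dots> = e / 2 + K\<^sup>2 * prob ?A"
      using int A by (subst Bochner_Integration.integral_add) (auto simp: prob_space)
    also have "\<dots> < e"
      using N[of n] n K_pos by (simp add: field_simps)
    finally have "expectation (gap n) < e" .
    moreover have "0 \<le> expectation (gap n)"
      by (rule integral_nonneg_AE) (auto intro: AE_I2 gap_nonneg)
    ultimately show ?thesis by simp
  qed
  then show "\<exists>N. \<forall>n\<ge>N. norm (expectation (gap n) - 0) < e" by blast
qed

lemma mean_expectation_gap: "(\<lambda>n. (\<Sum>i<n. expectation (gap i)) / n) \<longlonglongrightarrow> 0"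
  by (rule tendsto_cesaro_zero[OF expectation_gap])

text \<open>Markov's inequality for the average gap. The event says that the average information at
  \<open>\<theta>\<close> falls short of \<open>J\<close> by at least \<open>\<eta>\<close>.\<close>

lemma prob_info_small:
  assumes \<eta>: "0 < \<eta>"
  shows "(\<lambda>n. prob {\<omega>\<in>space M. (\<Sum>i<n. gap i \<omega>) / n \<ge> \<eta>}) \<longlonglongrightarrow> 0"
proof (rule tendsto_sandwich[OF _ _ tendsto_const])
  have int: "integrable M (\<lambda>\<omega>. (\<Sum>i<n. gap i \<omega>) / n)" for n
    using integrable_gap by simp
  have "prob {\<omega>\<in>space M. (\<Sum>i<n. gap i \<omega>) / n \<ge> \<eta>} \<le> expectation (\<lambda>\<omega>. (\<Sum>i<n. gap i \<omega>) / n) / \<eta>" for n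
    by (rule integral_Markov_inequality_measure[where A = "{}"])
       (use int \<eta> in \<open>auto intro!: AE_I2 divide_nonneg_nonneg sum_nonneg gap_nonneg\<close>)
  then show "\<forall>\<^sub>F n in sequentially. prob {\<omega>\<in>space M. (\<Sum>i<n. gap i \<omega>) / n \<ge> \<eta>}
      \<le> (\<Sum>i<n. expectation (gap i)) / n / \<eta>"
    using integrable_gap by simp
  show "(\<lambda>n. (\<Sum>i<n. expectation (gap i)) / n / \<eta>) \<longlonglongrightarrow> 0"
    using tendsto_divide[OF mean_expectation_gap tendsto_const, of \<eta>] \<eta> by simp
qed simp

lemma sum_gap: "(\<Sum>i<n. gap i \<omega>) = n * J - info b n \<theta> \<omega>"
  by (simp add: gap_def info_def sum_subtractf sum.atLeast1_atMost_eq)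

section \<open>Characteristic function of the score\<close>

text \<open>The score is left unscaled, so that \<open>h\<close> stays fixed while single steps are
  chained; \<open>h = t / sqrt n\<close> enters only in the limit.\<close>

definition char_S :: "nat \<Rightarrow> real \<Rightarrow> complex" where
  "char_S n h = expectation (\<lambda>\<omega>. iexp (h * S n \<omega>))"

text \<open>The summands are the cubic Taylor remainder, the error of \<open>1 - x\<close> for
  \<open>exp (- x)\<close> at \<open>x = h\<^sup>2 * J / 2\<close>, and the cost of putting
  \<open>J\<close> in place of the conditional variance.\<close>

definition step_error :: "real \<Rightarrow> nat \<Rightarrow> real" where
  "step_error h n = \<bar>h\<bar> ^ 3 * K ^ 3 + (h\<^sup>2 * J / 2)\<^sup>2 + h\<^sup>2 / 2 * expectation (gap n)"

text \<open>
  Multiplying \<open>char_S\<close> by the constant \<open>exp (- h\<^sup>2 J / 2)\<close>, rather than by the random factor with the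
  conditional variance in place of \<open>J\<close>, costs \<open>h\<^sup>2 / 2\<close> times the expected gap.
\<close>

lemma char_S_step:
  "cmod (char_S (Suc n) h - exp (- (h\<^sup>2 * J / 2)) * char_S n h) \<le> step_error h n"
proof -
  \<comment> \<open>\<open>P\<close> is the conditional characteristic function of the next
    increment given the past.\<close>
  define P where "P \<omega> = (\<Sum>k\<in>UNIV. complex_of_real (nrm_prob \<theta> (b (Suc n) \<omega>) k)
      * iexp (h * item_score \<theta> (b (Suc n) \<omega>) k))" for \<omega>
  define c where "c = exp (- (h\<^sup>2 * J / 2))"
  have [measurable]: "(\<lambda>\<omega>. nrm_prob \<theta> (b (Suc n) \<omega>) k) \<in> borel_measurable M"
    "(\<lambda>\<omega>. item_score \<theta> (b (Suc n) \<omega>) k) \<in> borel_measurable M" for k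
    by (intro measurable_nrm_prob measurable_item_score borel_measurable_const measurable_b; simp)+
  have [measurable]: "P \<in> borel_measurable M"
    unfolding P_def by measurable
  have P_le: "cmod (P \<omega>) \<le> 1" for \<omega>
  proof -
    have "cmod (P \<omega>) \<le> (\<Sum>k\<in>UNIV. nrm_prob \<theta> (b (Suc n) \<omega>) k)"
      unfolding P_def by (intro sum_norm_le) (simp add: norm_mult)
    then show ?thesis by (simp add: sum_nrm_prob)
  qed
  have "char_S (Suc n) h = expectation (\<lambda>\<omega>. iexp (h * (S n \<omega> + item_score \<theta> (b (Suc n) \<omega>) (X (Suc n) \<omega>))))"
    by (simp add: char_S_def score_Suc)
  also have "\<dots> = expectation (\<lambda>\<omega>. \<Sum>k\<in>UNIV. complex_of_real (nrm_prob \<theta> (b (Suc n) \<omega>) k)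
      * iexp (h * (S n \<omega> + item_score \<theta> (b (Suc n) \<omega>) k)))"
  proof (rule integral_response_complex[where C = 1])
    fix k
    have [measurable]: "S n \<in> borel_measurable (F n)"
      "(\<lambda>\<omega>. item_score \<theta> (b (Suc n) \<omega>) k) \<in> borel_measurable (F n)"
      by (intro measurable_S_F measurable_item_score borel_measurable_const measurable_b_F)+
    show "(\<lambda>\<omega>. iexp (h * (S n \<omega> + item_score \<theta> (b (Suc n) \<omega>) k))) \<in> borel_measurable (F n)"
      by measurable
  qed simp
  also have "\<dots> = expectation (\<lambda>\<omega>. iexp (h * S n \<omega>) * P \<omega>)"
    by (simp add: P_def sum_distrib_left ring_distribs exp_add mult_ac)
  finally have "char_S (Suc n) h - c * char_S n h
      = expectation (\<lambda>\<omega>. iexp (h * S n \<omega>) * P \<omega>) - expectation (\<lambda>\<omega>. iexp (h * S n \<omega>) * c)"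
    by (simp add: char_S_def mult.commute)
  also have "\<dots> = expectation (\<lambda>\<omega>. iexp (h * S n \<omega>) * P \<omega> - iexp (h * S n \<omega>) * c)"
  proof (rule Bochner_Integration.integral_diff[symmetric])
    show "complex_integrable M (\<lambda>\<omega>. iexp (h * S n \<omega>) * P \<omega>)"
      by (rule integrable_const_bound[of _ 1]) (auto simp: norm_mult P_le)
    show "complex_integrable M (\<lambda>\<omega>. iexp (h * S n \<omega>) * c)"
      by (rule integrable_const_bound[of _ "\<bar>c\<bar>"]) (auto simp: norm_mult)
  qed
  also have "cmod \<dots> \<le> expectation (\<lambda>\<omega>. cmod (iexp (h * S n \<omega>) * P \<omega> - iexp (h * S n \<omega>) * c))"
    by (rule integral_norm_bound)
  also have "\<dots> \<le> expectation (\<lambda>\<omega>. \<bar>h\<bar> ^ 3 * K ^ 3 + (h\<^sup>2 * J / 2)\<^sup>2 + h\<^sup>2 / 2 * gap n \<omega>)"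
  proof (rule integral_mono_AE')
    show "integrable M (\<lambda>\<omega>. \<bar>h\<bar> ^ 3 * K ^ 3 + (h\<^sup>2 * J / 2)\<^sup>2 + h\<^sup>2 / 2 * gap n \<omega>)"
      using integrable_gap by simp
    show "AE \<omega> in M. cmod (iexp (h * S n \<omega>) * P \<omega> - iexp (h * S n \<omega>) * c)
        \<le> \<bar>h\<bar> ^ 3 * K ^ 3 + (h\<^sup>2 * J / 2)\<^sup>2 + h\<^sup>2 / 2 * gap n \<omega>"
    proof (rule AE_I2)
      fix \<omega> assume \<omega>: "\<omega> \<in> space M"
      let ?v = "item_info \<theta> (b (Suc n) \<omega>)"
      have "cmod (iexp (h * S n \<omega>) * P \<omega> - iexp (h * S n \<omega>) * c) = cmod (P \<omega> - c)"
        by (simp add: norm_mult flip: right_diff_distrib)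
      \<comment> \<open>The three parts correspond to the three summands of
        \<open>step_error\<close>.\<close>
      also have "P \<omega> - c = (P \<omega> - complex_of_real (1 - h\<^sup>2 * ?v / 2))
          + (complex_of_real (1 - h\<^sup>2 * J / 2 - c) + complex_of_real (h\<^sup>2 / 2 * gap n \<omega>))"
        by (simp add: gap_def algebra_simps diff_divide_distrib)
      also have "cmod \<dots> \<le> cmod (P \<omega> - complex_of_real (1 - h\<^sup>2 * ?v / 2))
          + (\<bar>1 - h\<^sup>2 * J / 2 - c\<bar> + \<bar>h\<^sup>2 / 2 * gap n \<omega>\<bar>)"
        by (metis (no_types) norm_of_real norm_triangle_ineq norm_triangle_mono order_refl)
      also have "cmod (P \<omega> - complex_of_real (1 - h\<^sup>2 * ?v / 2)) \<le> \<bar>h\<bar> ^ 3 * K ^ 3"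
        unfolding P_def using \<omega> by (intro item_score_char_approx item_score_le_K b_in_B) auto
      also have "\<bar>1 - h\<^sup>2 * J / 2 - c\<bar> \<le> (h\<^sup>2 * J / 2)\<^sup>2"
        unfolding c_def using J_pos one_minus_exp_neg_bounds[of "h\<^sup>2 * J / 2"]
        by (simp add: abs_minus_commute)
      also have "\<bar>h\<^sup>2 / 2 * gap n \<omega>\<bar> = h\<^sup>2 / 2 * gap n \<omega>"
        using gap_nonneg[OF \<omega>] by simp
      finally show "cmod (iexp (h * S n \<omega>) * P \<omega> - iexp (h * S n \<omega>) * c)
        \<le> \<bar>h\<bar> ^ 3 * K ^ 3 + (h\<^sup>2 * J / 2)\<^sup>2 + h\<^sup>2 / 2 * gap n \<omega>" by simp
    qed
    show "AE \<omega> in M. 0 \<le> \<bar>h\<bar> ^ 3 * K ^ 3 + (h\<^sup>2 * J / 2)\<^sup>2 + h\<^sup>2 / 2 * gap n \<omega>"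
      using K_pos by (intro AE_I2 add_nonneg_nonneg mult_nonneg_nonneg gap_nonneg) auto
  qed
  also have "\<dots> = step_error h n"
    using integrable_gap by (simp add: step_error_def prob_space)
  finally show ?thesis by (simp add: c_def)
qed

text \<open>The errors of the single steps merely add up, since the factor
  \<open>exp (- (h\<^sup>2 * J / 2))\<close> is at most \<open>1\<close> and does not amplify
  earlier ones.\<close>

lemma char_S_approx:
  "cmod (char_S n h - exp (- (h\<^sup>2 * J / 2)) ^ n) \<le> (\<Sum>i<n. step_error h i)"
proof (induction n)
  case 0
  then show ?case by (simp add: char_S_def score_def prob_space)
next
  case (Suc n)
  let ?c = "exp (- (h\<^sup>2 * J / 2))"
  have "char_S (Suc n) h - ?c ^ Suc n = (char_S (Suc n) h - ?c * char_S n h) + ?c * (char_S n h - ?c ^ n)"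
    by (simp add: algebra_simps)
  then have "cmod (char_S (Suc n) h - ?c ^ Suc n)
      \<le> cmod (char_S (Suc n) h - ?c * char_S n h) + cmod (?c * (char_S n h - ?c ^ n))"
    by (simp only: norm_triangle_ineq)
  also have "\<dots> \<le> step_error h n + 1 * cmod (char_S n h - ?c ^ n)"
    unfolding norm_mult using J_pos by (intro add_mono char_S_step mult_right_mono) auto
  finally show ?case using Suc by simp
qed

text \<open>For \<open>h = t / sqrt n\<close> the \<open>n\<close> Taylor remainders add up to order
  \<open>1 / sqrt n\<close>, the exponential errors to order \<open>1 / n\<close>, and the gaps
  enter through their Cesaro mean.\<close>

lemma char_S_limit: "(\<lambda>n. char_S n (t / sqrt n)) \<longlonglongrightarrow> exp (- (t\<^sup>2 * J / 2))"
proof -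
  have bound: "cmod (char_S n (t / sqrt n) - exp (- (t\<^sup>2 * J / 2)))
      \<le> \<bar>t\<bar> ^ 3 * K ^ 3 * (1 / sqrt n) + (t\<^sup>2 * J / 2)\<^sup>2 * (1 / n)
        + t\<^sup>2 / 2 * ((\<Sum>i<n. expectation (gap i)) / n)" if n: "1 \<le> n" for n
  proof -
    have h2: "(t / sqrt n)\<^sup>2 = t\<^sup>2 / n" by (simp add: power_divide)
    have h3: "\<bar>t / sqrt n\<bar> ^ 3 = \<bar>t\<bar> ^ 3 / (n * sqrt n)"
      by (simp add: power_divide power3_eq_cube)
    have "exp (- ((t / sqrt n)\<^sup>2 * J / 2)) ^ n = exp (- (t\<^sup>2 * J / 2))"
      using n by (simp add: h2 flip: exp_of_nat_mult)
    then have "cmod (char_S n (t / sqrt n) - exp (- (t\<^sup>2 * J / 2))) \<le> (\<Sum>i<n. step_error (t / sqrt n) i)"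
      using char_S_approx[of n "t / sqrt n"] by (simp flip: of_real_power)
    also have "\<dots> = n * (\<bar>t\<bar> ^ 3 / (n * sqrt n) * K ^ 3) + n * (t\<^sup>2 / n * J / 2)\<^sup>2
        + t\<^sup>2 / n / 2 * (\<Sum>i<n. expectation (gap i))"
      unfolding step_error_def h2 h3 by (simp add: sum.distrib sum_distrib_left ring_distribs)
    also have "\<dots> = \<bar>t\<bar> ^ 3 * K ^ 3 * (1 / sqrt n) + (t\<^sup>2 * J / 2)\<^sup>2 * (1 / n)
        + t\<^sup>2 / 2 * ((\<Sum>i<n. expectation (gap i)) / n)"
      using n by (simp add: field_simps power2_eq_square)
    finally show ?thesis .
  qed
  have "(\<lambda>n. \<bar>t\<bar> ^ 3 * K ^ 3 * (1 / sqrt n) + (t\<^sup>2 * J / 2)\<^sup>2 * (1 / n)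
        + t\<^sup>2 / 2 * ((\<Sum>i<n. expectation (gap i)) / n)) \<longlonglongrightarrow>
      \<bar>t\<bar> ^ 3 * K ^ 3 * 0 + (t\<^sup>2 * J / 2)\<^sup>2 * 0 + t\<^sup>2 / 2 * 0"
  proof (intro tendsto_add tendsto_mult tendsto_const mean_expectation_gap)
    show "(\<lambda>n. 1 / sqrt (real n)) \<longlonglongrightarrow> 0"
      using filterlim_compose[OF sqrt_at_top filterlim_real_sequentially]
      by (intro real_tendsto_divide_at_top[OF tendsto_const])
  qed (rule lim_1_over_n)
  then have "(\<lambda>n. char_S n (t / sqrt n) - exp (- (t\<^sup>2 * J / 2))) \<longlonglongrightarrow> 0"
    by (intro Lim_null_comparison[OF eventually_sequentiallyI[OF bound]]) simp_all
  then show ?thesis by (rule LIM_zero_cancel)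
qed

section \<open>Linearization of the score at the estimate\<close>

text \<open>The score vanishes at the estimate, so \<open>S n\<close> is a sum of differences of
  mean slopes, to which the mean value theorem applies item by item; \<open>R\<close> is the average
  of the resulting factors.\<close>

lemma score_linearization:
  assumes n: "1 \<le> n" and \<omega>: "\<omega> \<in> space M"
    and close: "\<And>v t. v \<in> B \<Longrightarrow> \<bar>t - \<theta>\<bar> < \<delta> \<Longrightarrow> \<bar>item_info t v - item_info \<theta> v\<bar> \<le> \<eta>"
    and loc: "located \<delta> n \<omega>"
    and gap: "(\<Sum>i<n. gap i \<omega>) / n < \<eta>"
  shows "\<bar>info b n (\<theta>hat n \<omega>) \<omega> / n - J\<bar> < 2 * \<eta>"
    and "\<exists>R::real. S n \<omega> = (\<theta>hat n \<omega> - \<theta>) * (n * R) \<and> \<bar>R - J\<bar> < 2 * \<eta>"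
proof -
  have B: "b i \<omega> \<in> B" if "i \<in> {1..n}" for i
    using that \<omega> by (intro b_in_B) auto
  have t: "\<bar>\<theta>hat n \<omega> - \<theta>\<bar> < \<delta>" and root: "score b X n (\<theta>hat n \<omega>) \<omega> = 0"
    using loc by (auto simp: located_def)
  \<comment> \<open>Both claims concern averages of numbers within \<open>\<eta>\<close> of the item
    informations at \<open>\<theta>\<close>, whose own average lies less than \<open>\<eta>\<close>
    below \<open>J\<close>.\<close>
  have near: "\<bar>(\<Sum>i=1..n. r i) / n - J\<bar> < 2 * \<eta>"
    if r: "\<And>i. i \<in> {1..n} \<Longrightarrow> \<bar>r i - item_info \<theta> (b i \<omega>)\<bar> \<le> \<eta>" for r :: "nat \<Rightarrow> real"
  proof -
    have "\<bar>(\<Sum>i=1..n. r i) - info b n \<theta> \<omega>\<bar> \<le> (\<Sum>i=1..n. \<bar>r i - item_info \<theta> (b i \<omega>)\<bar>)"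
      unfolding info_def sum_subtractf[symmetric] by (rule sum_abs)
    also have "\<dots> \<le> (\<Sum>i=1..n. \<eta>)" by (intro sum_mono r)
    finally have 1: "\<bar>(\<Sum>i=1..n. r i) - info b n \<theta> \<omega>\<bar> \<le> n * \<eta>" by simp
    have 2: "n * J - info b n \<theta> \<omega> < n * \<eta>"
      using gap n by (simp add: sum_gap field_simps)
    have 3: "0 \<le> n * J - info b n \<theta> \<omega>"
      unfolding sum_gap[symmetric] using \<omega> by (intro sum_nonneg gap_nonneg)
    have "\<bar>(\<Sum>i=1..n. r i) - n * J\<bar> < n * (2 * \<eta>)" using 1 2 3 by (simp add: abs_le_iff abs_less_iff)
    moreover have "(\<Sum>i=1..n. r i) / n - J = ((\<Sum>i=1..n. r i) - n * J) / n"
      using n by (simp add: field_simps)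
    ultimately show ?thesis using n by (simp add: abs_divide divide_less_eq mult.commute)
  qed
  show "\<bar>info b n (\<theta>hat n \<omega>) \<omega> / n - J\<bar> < 2 * \<eta>"
    unfolding info_def by (rule near) (intro close B t)
  have "\<forall>i\<in>{1..n}. \<exists>r. mean_slope (\<theta>hat n \<omega>) (b i \<omega>) - mean_slope \<theta> (b i \<omega>) = (\<theta>hat n \<omega> - \<theta>) * r
      \<and> \<bar>r - item_info \<theta> (b i \<omega>)\<bar> \<le> \<eta>"
    by (intro ballI mean_slope_mvt[OF _ t] close B)
  then obtain r where r: "\<And>i. i \<in> {1..n} \<Longrightarrow>
      mean_slope (\<theta>hat n \<omega>) (b i \<omega>) - mean_slope \<theta> (b i \<omega>) = (\<theta>hat n \<omega> - \<theta>) * r i"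
      "\<And>i. i \<in> {1..n} \<Longrightarrow> \<bar>r i - item_info \<theta> (b i \<omega>)\<bar> \<le> \<eta>"
    by metis
  have "S n \<omega> = S n \<omega> - score b X n (\<theta>hat n \<omega>) \<omega>" using root by simp
  also have "\<dots> = (\<Sum>i=1..n. mean_slope (\<theta>hat n \<omega>) (b i \<omega>) - mean_slope \<theta> (b i \<omega>))"
    by (simp add: score_def item_score_def sum_subtractf)
  also have "\<dots> = (\<theta>hat n \<omega> - \<theta>) * (\<Sum>i=1..n. r i)"
    unfolding sum_distrib_left by (intro sum.cong r(1) refl)
  finally show "\<exists>R::real. S n \<omega> = (\<theta>hat n \<omega> - \<theta>) * (n * R) \<and> \<bar>R - J\<bar> < 2 * \<eta>"
    using n near[OF r(2)] by (intro exI[of _ "(\<Sum>i=1..n. r i) / n"]) simp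
qed

text \<open>
  The two claims of the theorem are the cases \<open>g = sqrt\<close> and \<open>g = 1\<close>.
\<close>

lemma weak_conv_scaled_error:
  fixes g :: "real \<Rightarrow> real"
  assumes [measurable]: "g \<in> borel_measurable borel" and g: "isCont g J" "0 < g J"
  shows "weak_conv_m
      (\<lambda>n. distr M borel (\<lambda>\<omega>. g (info b n (\<theta>hat n \<omega>) \<omega> / n) * (sqrt n * (\<theta>hat n \<omega> - \<theta>))))
      (density lborel (normal_density 0 (g J / J * sqrt J)))"
proof (rule weak_conv_m_normal_perturb[where W = "\<lambda>n \<omega>. S n \<omega> / sqrt n" and C = "K\<^sup>2"])
  show "(\<lambda>\<omega>. g (info b n (\<theta>hat n \<omega>) \<omega> / n) * (sqrt n * (\<theta>hat n \<omega> - \<theta>))) \<in> borel_measurable M" for n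
  proof (cases "n = 0")
    case False
    then have [measurable]: "\<theta>hat n \<in> borel_measurable M" by (intro measurable_\<theta>hat) simp
    note measurable_info[OF this, measurable]
    show ?thesis by measurable
  qed simp
  show "integrable M (\<lambda>\<omega>. (S n \<omega> / sqrt n)\<^sup>2)" for n
    using integrable_S2 by (simp add: power_divide)
  show "expectation (\<lambda>\<omega>. (S n \<omega> / sqrt n)\<^sup>2) \<le> K\<^sup>2" for n
    using expectation_S2_le[of n] by (cases "n = 0") (simp_all add: power_divide divide_le_eq mult.commute)
  show "(\<lambda>n. expectation (\<lambda>\<omega>. iexp (t * (S n \<omega> / sqrt n)))) \<longlonglongrightarrow> exp (- (t\<^sup>2 * (sqrt J)\<^sup>2 / 2))" for t
    using char_S_limit[of t] J_pos by (simp add: char_S_def)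
  show "0 < g J / J" "0 < sqrt J" using g J_pos by auto
  fix \<epsilon> :: real assume \<epsilon>: "0 < \<epsilon>"
  \<comment> \<open>The information at the estimate and the factor \<open>R\<close> are different
    averages, both close to \<open>J\<close>; joint continuity of the quotient treats them
    together.\<close>
  have "isCont (\<lambda>z. g (fst z) / snd z) (J, J)"
  proof (rule isCont_divide)
    show "isCont (\<lambda>z. g (fst z)) (J, J)"
      using g(1) by (intro isCont_o2[where f = fst and g = g] isCont_fst continuous_ident) simp
    show "isCont snd (J, J)" by (intro isCont_snd continuous_ident)
  qed (use J_pos in simp)
  then obtain e where e: "0 < e" "\<And>z. dist z (J, J) < e \<Longrightarrow> dist (g (fst z) / snd z) (g J / J) < \<epsilon>"
    unfolding continuous_at_eps_delta using \<epsilon> by force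
  \<comment> \<open>With \<open>e / 4\<close>, two deviations below \<open>2 * \<eta>\<close> sum to
    less than \<open>e\<close>; with \<open>J / 2\<close>, the denominator \<open>y\<close> stays
    positive.\<close>
  define \<eta> where "\<eta> = min (e / 4) (J / 2)"
  have \<eta>: "0 < \<eta>" using e(1) J_pos by (simp add: \<eta>_def)
  have ratio: "0 < y \<and> \<bar>g x / y - g J / J\<bar> < \<epsilon>" if "\<bar>x - J\<bar> < 2 * \<eta>" "\<bar>y - J\<bar> < 2 * \<eta>" for x y
  proof -
    have "dist (x, y) (J, J) \<le> \<bar>x - J\<bar> + \<bar>y - J\<bar>"
      by (simp add: dist_Pair_Pair dist_real_def sqrt_sum_squares_le_sum_abs)
    also have "\<dots> < e" using that by (simp add: \<eta>_def)
    finally show ?thesis using e(2)[of "(x, y)"] that by (auto simp: \<eta>_def dist_real_def)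
  qed
  obtain \<delta> where \<delta>: "0 < \<delta>"
    "\<And>v t. v \<in> B \<Longrightarrow> \<bar>t - \<theta>\<bar> < \<delta> \<Longrightarrow> \<bar>item_info t v - item_info \<theta> v\<bar> \<le> \<eta>"
    using item_info_close[OF \<eta>] by auto
  let ?G = "\<lambda>n \<omega>. g (info b n (\<theta>hat n \<omega>) \<omega> / n) * (sqrt n * (\<theta>hat n \<omega> - \<theta>))"
  have good: "\<bar>?G n \<omega> - g J / J * (S n \<omega> / sqrt n)\<bar> \<le> \<epsilon> * \<bar>S n \<omega> / sqrt n\<bar>"
    if n: "1 \<le> n" and \<omega>: "\<omega> \<in> space M" and ok: "located \<delta> n \<omega>" "(\<Sum>i<n. gap i \<omega>) / n < \<eta>" for n \<omega>
  proof -
    obtain R :: real where R: "S n \<omega> = (\<theta>hat n \<omega> - \<theta>) * (n * R)" "\<bar>R - J\<bar> < 2 * \<eta>"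
      using score_linearization(2)[OF n \<omega> \<delta>(2) ok] by blast
    note x = ratio[OF score_linearization(1)[OF n \<omega> \<delta>(2) ok] R(2)]
    \<comment> \<open>Since \<open>R\<close> is positive, the linearization can be solved for the
      estimation error.\<close>
    have "sqrt n * (\<theta>hat n \<omega> - \<theta>) = S n \<omega> / sqrt n / R"
      using x n unfolding R(1) by (simp add: field_simps)
    then have "?G n \<omega> - g J / J * (S n \<omega> / sqrt n)
        = (g (info b n (\<theta>hat n \<omega>) \<omega> / n) / R - g J / J) * (S n \<omega> / sqrt n)"
      by (simp add: algebra_simps)
    then show ?thesis
      using x by (simp only: abs_mult) (intro mult_right_mono; simp)
  qed
  show "(\<lambda>n. prob {\<omega>\<in>space M. \<not> \<bar>?G n \<omega> - g J / J * (S n \<omega> / sqrt n)\<bar> \<le> \<epsilon> * \<bar>S n \<omega> / sqrt n\<bar>}) \<longlonglongrightarrow> 0"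
  proof (rule tendsto_sandwich[OF _ _ tendsto_const])
    show "(\<lambda>n. prob {\<omega>\<in>space M. \<not> located \<delta> n \<omega>} + prob {\<omega>\<in>space M. (\<Sum>i<n. gap i \<omega>) / n \<ge> \<eta>}) \<longlonglongrightarrow> 0"
      using tendsto_add[OF prob_not_located[OF \<delta>(1)] prob_info_small[OF \<eta>]] by simp
    show "\<forall>\<^sub>F n in sequentially.
        prob {\<omega>\<in>space M. \<not> \<bar>?G n \<omega> - g J / J * (S n \<omega> / sqrt n)\<bar> \<le> \<epsilon> * \<bar>S n \<omega> / sqrt n\<bar>}
        \<le> prob {\<omega>\<in>space M. \<not> located \<delta> n \<omega>} + prob {\<omega>\<in>space M. (\<Sum>i<n. gap i \<omega>) / n \<ge> \<eta>}"
    proof (rule eventually_sequentiallyI[of 1])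
      fix n :: nat assume n: "1 \<le> n"
      have "prob {\<omega>\<in>space M. \<not> \<bar>?G n \<omega> - g J / J * (S n \<omega> / sqrt n)\<bar> \<le> \<epsilon> * \<bar>S n \<omega> / sqrt n\<bar>}
          \<le> prob ({\<omega>\<in>space M. \<not> located \<delta> n \<omega>} \<union> {\<omega>\<in>space M. (\<Sum>i<n. gap i \<omega>) / n \<ge> \<eta>})"
        using good[OF n] located_sets[OF n]
        by (intro finite_measure_mono) (auto simp flip: not_less)
      also have "\<dots> \<le> prob {\<omega>\<in>space M. \<not> located \<delta> n \<omega>} + prob {\<omega>\<in>space M. (\<Sum>i<n. gap i \<omega>) / n \<ge> \<eta>}"
        using located_sets[OF n] by (intro measure_Un_le) auto
      finally show "prob {\<omega>\<in>space M. \<not> \<bar>?G n \<omega> - g J / J * (S n \<omega> / sqrt n)\<bar> \<le> \<epsilon> * \<bar>S n \<omega> / sqrt n\<bar>}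
        \<le> prob {\<omega>\<in>space M. \<not> located \<delta> n \<omega>} + prob {\<omega>\<in>space M. (\<Sum>i<n. gap i \<omega>) / n \<ge> \<eta>}" .
    qed
  qed simp
qed simp

end

theorem theorem3p2:
  fixes M :: "'w measure"
    and \<theta> :: real
    and B :: "'k::finite item set"
    and X :: "nat \<Rightarrow> 'w \<Rightarrow> 'k option"
    and b :: "nat \<Rightarrow> 'w \<Rightarrow> 'k item"
    and \<theta>hat :: "nat \<Rightarrow> 'w \<Rightarrow> real"
  assumes "prob_space M"
    and "compact B" and "B \<noteq> {}" and "\<And>v. v \<in> B \<Longrightarrow> admissible_item v"
    and "item_selection_strategy M B X b"
    and "nrm_responses M \<theta> X b"
    and "ability_estimator M X b \<theta>hat"
    and info_max: "\<And>i \<omega>. i \<ge> 1 \<Longrightarrow> \<omega> \<in> space M \<Longrightarrow>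
          is_arg_max (item_info (\<theta>hat i \<omega>)) (\<lambda>v. v \<in> B) (b (Suc i) \<omega>)"
  shows "weak_conv_m
           (\<lambda>n. distr M borel (\<lambda>\<omega>. sqrt (info b n (\<theta>hat n \<omega>) \<omega>) * (\<theta>hat n \<omega> - \<theta>)))
           std_normal_distribution
       \<and> weak_conv_m
           (\<lambda>n. distr M borel (\<lambda>\<omega>. sqrt (real n) * (\<theta>hat n \<omega> - \<theta>)))
           (density lborel (normal_density 0 (sqrt (inverse (max_info B \<theta>)))))"
proof -
  interpret prob_space M by (rule assms(1))
  interpret info_maximizing_cat M \<theta> B X b \<theta>hat
    by unfold_locales (rule assms; assumption)+
  have J: "sqrt J / J * sqrt J = 1" "1 / J * sqrt J = sqrt (inverse J)"
    using J_pos by (simp, subst real_sqrt_inverse, simp add: field_simps)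
  \<comment> \<open>For \<open>g = sqrt\<close> the two factors \<open>sqrt n\<close> cancel; at
    \<open>n = 0\<close> the information is an empty sum and both sides are
    \<open>0\<close>.\<close>
  have scale: "sqrt (info b n (\<theta>hat n \<omega>) \<omega> / n) * (sqrt n * (\<theta>hat n \<omega> - \<theta>))
      = sqrt (info b n (\<theta>hat n \<omega>) \<omega>) * (\<theta>hat n \<omega> - \<theta>)" for n \<omega>
    by (cases "n = 0") (simp_all add: info_def real_sqrt_divide)
  show ?thesis
    using weak_conv_scaled_error[of sqrt] weak_conv_scaled_error[of "\<lambda>_. 1"] J_pos
    unfolding J scale by (simp add: isCont_real_sqrt)
qed

end
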